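(* Let $\mathbf u\in\mathbb Z^n_{>0}$, $Q\in S$ a nonzero $\mathbf u$-homogeneous polynomial, and $\mathbf v\in\mathbb Z^n$ with $\mathbf u+\mathbf v=(k,\dots,k)$ for some $k\in\mathbb Z$. Then $\chi\big(D^{(\mathbf u,\mathbf v)}(Q)\big)=\deg^{\mathbf u}(Q)+|\mathbf v|$.
   Context: $\mathbb K$ a field of characteristic zero, $S=\mathbb K[x_1,\dots,x_n]$, $D=\mathrm{Der}_{\mathbb K}(S)$ with basis $\partial_i=\partial/\partial x_i$. For $g\in S$, $e\ge1$: $D(g;e)=\{\delta\in D:\delta(g)\in g^eS\}$; for nonzero $f=cf_1^{e_1}\cdots f_r^{e_r}$ (pairwise non-associate irreducibles), $D(f)=\bigcap_iD(f_i;e_i)$. $S^{\mathbf u}$: $S$ graded by $\deg x_i=u_i$, $\deg^{\mathbf u}$ the weighted degree. $D^{(\mathbf u,\mathbf v)}$: $D$ graded by $\deg(a\partial_i)=\deg^{\mathbf u}(a)+v_i$; $D^{(\mathbf u,\mathbf v)}(Q)$ is $D(Q)$ with the induced grading. $|\mathbf v|=\sum v_i$. For a finitely generated graded $S^{\mathbf u}$-module $M$, $HP_M(t)=\sum_j\dim_{\mathbb K}M_jt^j$ and $\chi(M)=\big[\prod_i(1-t^{u_i})HP_M(t)\big]'(1)$. *)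

theory Defs
  imports Complex_Main "HOL-Library.Poly_Mapping" "HOL-Library.Function_Algebras" "HOL-Computational_Algebra.Factorial_Ring"
begin

type_synonym ('n, 'a) mpoly = "('n \<Rightarrow>\<^sub>0 nat) \<Rightarrow>\<^sub>0 'a"

definition pderiv_var :: "'n \<Rightarrow> ('n, 'a::comm_ring_1) mpoly \<Rightarrow> ('n, 'a) mpoly" where
  "pderiv_var i p = (\<Sum>m\<in>Poly_Mapping.keys p.
      Poly_Mapping.single (m - Poly_Mapping.single i (1::nat))
        (of_nat (Poly_Mapping.lookup m i) * Poly_Mapping.lookup p m))"

text \<open>A derivation delta = sum_i a_i d_i is represented by its coefficient vector a;
  its action on g.\<close>
definition der_apply :: "('n::finite \<Rightarrow> ('n, 'a::comm_ring_1) mpoly) \<Rightarrow> ('n, 'a) mpoly \<Rightarrow> ('n, 'a) mpoly" where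
  "der_apply a g = (\<Sum>i\<in>UNIV. a i * pderiv_var i g)"

definition Der_mult :: "('n::finite, 'a::comm_ring_1) mpoly \<Rightarrow> nat \<Rightarrow> ('n \<Rightarrow> ('n, 'a) mpoly) set" where
  "Der_mult g e = {a. g ^ e dvd der_apply a g}"

definition mult_in :: "'b::comm_semiring_1 \<Rightarrow> 'b \<Rightarrow> nat" where
  "mult_in g f = (if finite {e. g ^ e dvd f} then Max {e. g ^ e dvd f} else 0)"

definition Der_log :: "('n::finite, 'a::comm_ring_1) mpoly \<Rightarrow> ('n \<Rightarrow> ('n, 'a) mpoly) set" where
  "Der_log f = {a. \<forall>g. irreducible g \<and> g dvd f \<longrightarrow> a \<in> Der_mult g (mult_in g f)}"

text \<open>Weighted degree of a monomial and weighted homogeneity (0 is homogeneous of every degree).\<close>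
definition wdeg :: "('n::finite \<Rightarrow> int) \<Rightarrow> ('n \<Rightarrow>\<^sub>0 nat) \<Rightarrow> int" where
  "wdeg u \<alpha> = (\<Sum>i\<in>UNIV. u i * int (Poly_Mapping.lookup \<alpha> i))"

definition whomog :: "('n::finite \<Rightarrow> int) \<Rightarrow> int \<Rightarrow> ('n, 'a::zero) mpoly \<Rightarrow> bool" where
  "whomog u d p \<longleftrightarrow> (\<forall>\<alpha>\<in>Poly_Mapping.keys p. wdeg u \<alpha> = d)"

text \<open>Degree-j piece of D^(u,v)(Q): deg(a d_i) = deg^u(a) + v_i.\<close>
definition Der_piece :: "('n::finite \<Rightarrow> int) \<Rightarrow> ('n \<Rightarrow> int) \<Rightarrow> ('n, 'a::comm_ring_1) mpoly \<Rightarrow> int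
    \<Rightarrow> ('n \<Rightarrow> ('n, 'a) mpoly) set" where
  "Der_piece u v Q j = {a \<in> Der_log Q. \<forall>i. whomog u (j - v i) (a i)}"

definition der_scale :: "'a::comm_ring_1 \<Rightarrow> ('n \<Rightarrow> ('n, 'a) mpoly) \<Rightarrow> ('n \<Rightarrow> ('n, 'a) mpoly)" where
  "der_scale c a = (\<lambda>i. Poly_Mapping.single 0 c * a i)"

definition hilb :: "('n::finite \<Rightarrow> int) \<Rightarrow> ('n \<Rightarrow> int) \<Rightarrow> ('n, 'a::field) mpoly \<Rightarrow> int \<Rightarrow> nat" where
  "hilb u v Q j = vector_space.dim der_scale (Der_piece u v Q j)"

text \<open>Coefficient of t^m in prod_i (1 - t^(u_i)) * HP(t).\<close>
definition hilb_num :: "('n::finite \<Rightarrow> int) \<Rightarrow> ('n \<Rightarrow> int) \<Rightarrow> ('n, 'a::field) mpoly \<Rightarrow> int \<Rightarrow> int" where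
  "hilb_num u v Q m = (\<Sum>A\<in>Pow UNIV. (-1) ^ card A * int (hilb u v Q (m - (\<Sum>i\<in>A. u i))))"

text \<open>chi = derivative at t = 1 of the Laurent polynomial sum_m c_m t^m, i.e. sum_m m c_m.\<close>
definition chi_der :: "('n::finite \<Rightarrow> int) \<Rightarrow> ('n \<Rightarrow> int) \<Rightarrow> ('n, 'a::field) mpoly \<Rightarrow> int" where
  "chi_der u v Q = (\<Sum>m\<in>{m. hilb_num u v Q m \<noteq> 0}. m * hilb_num u v Q m)"

end

theory Submission
  imports Defs "HOL-Library.Countable" "HOL-Library.FuncSet"
begin

text \<open>
  Write \<open>Q = p^e Q'\<close> with \<open>p\<close> irreducible and prime to \<open>Q'\<close>. Then \<open>D(Q) = D(Q') \<inter> D(p;e)\<close> is the kernel of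
  \<open>\<delta> \<mapsto> \<delta>(p)\<close> from \<open>D(Q')\<close> to \<open>S/p^eS\<close>, and \<open>u + v\<close> being constant makes this map homogeneous. Its
  image is \<open>J/p^eS\<close> for an ideal \<open>J\<close> containing \<open>p^e\<close> and \<open>Q' \<partial>p/\<partial>x\<^sub>l\<close>, which are coprime for a suitable
  \<open>l\<close>. An ideal of height at least two has the same \<open>\<chi>\<close> as \<open>S\<close>, namely \<open>0\<close>, while
  \<open>\<chi>(p^eS) = e deg p\<close>; hence \<open>\<chi>(D(Q)) = \<chi>(D(Q')) + e deg p\<close>, and induction ends at \<open>\<chi>(D) = |v|\<close>.

  For an ideal, \<open>\<chi>\<close> is read off the leading monomials: it is the weighted degree of their greatest
  common divisor. In particular \<open>\<chi>\<close> is antitone in the ideal.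
\<close>

section \<open>Leading monomials and weighted degrees\<close>

text \<open>The condition \<open>u i + v i = k\<close> is what gives \<delta> \<mapsto> \<delta>(p)
  a single degree: on a derivation of degree j the summand \<open>a i * pderiv_var i p\<close> has
  degree (j - v_i) + (deg p - u_i) = j - k + deg p. The resulting shift k - deg p affects both J and
  p^eS, and multiplying by t^a changes a derivative at 1 by a times the value at 1. So the value at
  1 is carried along with \<chi>; it is 1 for every nonzero ideal, and the shifts cancel in the
  difference. No quotient is formed: the kernel is counted degree by degree through dim V + dim N =
  dim (f(V) + N) + dim {v \<in> V. f v \<in> N}, with N a piece of p^eS. The index l comes from
  characteristic zero: a nonconstant p has a nonzero partial derivative, whose smaller degree keeps
  p from dividing it. Coprimality of p^e and Q' \<partial>p/\<partial>x_l further uses that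
  irreducible polynomials are prime, which is proved by induction on the set of variables.\<close>

abbreviation lookup where "lookup \<equiv> Poly_Mapping.lookup"
abbreviation keys where "keys \<equiv> Poly_Mapping.keys"
abbreviation single where "single \<equiv> Poly_Mapping.single"

lemma poly_mapping_sum_singles: "p = (\<Sum>m\<in>keys p. single m (lookup p m))"
proof (rule poly_mapping_eqI)
  fix k
  have "lookup (\<Sum>m\<in>keys p. single m (lookup p m)) k = (\<Sum>m\<in>keys p. if k = m then lookup p m else 0)"
    by (simp add: lookup_sum lookup_single when_def eq_commute)
  then show "lookup p k = lookup (\<Sum>m\<in>keys p. single m (lookup p m)) k"
    by (simp add: in_keys_iff)
qed

lemma lookup_mult_keys:
  fixes p q :: "('b::comm_monoid_add) \<Rightarrow>\<^sub>0 ('a::comm_semiring_0)"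
  shows "lookup (p * q) k =
    (\<Sum>a\<in>keys p. \<Sum>b\<in>keys q. if a + b = k then lookup p a * lookup q b else 0)"
proof -
  have "p * q = (\<Sum>a\<in>keys p. single a (lookup p a)) * (\<Sum>b\<in>keys q. single b (lookup q b))"
    using poly_mapping_sum_singles[of p] poly_mapping_sum_singles[of q] by simp
  then show ?thesis
    by (simp add: sum_product mult_single lookup_sum lookup_single when_def)
qed

lemma lookup_single_zero_mult [simp]:
  fixes p :: "('b::cancel_comm_monoid_add) \<Rightarrow>\<^sub>0 ('a::comm_semiring_0)"
  shows "lookup (single 0 c * p) k = c * lookup p k"
  by (auto simp: lookup_mult_keys in_keys_iff)

text \<open>The variables carry no order, so monomials are compared lexicographically through an
  enumeration of the variables.\<close>

definition lex_key :: "('n::finite \<Rightarrow>\<^sub>0 nat) \<Rightarrow> (nat \<Rightarrow>\<^sub>0 nat)" where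
  "lex_key \<alpha> = (\<Sum>i\<in>UNIV. single (to_nat i) (lookup \<alpha> i))"

lemma lex_key_add: "lex_key (\<alpha> + \<beta>) = lex_key \<alpha> + lex_key \<beta>"
  by (simp add: lex_key_def lookup_add single_add sum.distrib)

lemma lookup_lex_key: "lookup (lex_key \<alpha>) (to_nat i) = lookup \<alpha> i"
proof -
  have "lookup (lex_key \<alpha>) (to_nat i) = (\<Sum>j\<in>UNIV. if i = j then lookup \<alpha> j else 0)"
    by (simp add: lex_key_def lookup_sum lookup_single when_def eq_commute)
  then show ?thesis by simp
qed

lemma lex_key_inject [simp]: "lex_key \<alpha> = lex_key \<beta> \<longleftrightarrow> \<alpha> = \<beta>"
  by (metis lookup_lex_key poly_mapping_eqI)

definition lead :: "('n::finite, 'a::zero) mpoly \<Rightarrow> ('n \<Rightarrow>\<^sub>0 nat)" where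
  "lead p = inv_into (keys p) lex_key (Max (lex_key ` keys p))"

lemma keys_nonempty: "p \<noteq> 0 \<Longrightarrow> keys p \<noteq> {}"
  by (metis all_not_in_conv in_keys_iff lookup_zero poly_mapping_eqI)

lemma lead_in_keys: "p \<noteq> 0 \<Longrightarrow> lead p \<in> keys p"
  and lex_key_lead: "p \<noteq> 0 \<Longrightarrow> lex_key (lead p) = Max (lex_key ` keys p)"
proof -
  assume "p \<noteq> 0"
  then have "Max (lex_key ` keys p) \<in> lex_key ` keys p"
    by (intro Max_in) (auto dest: keys_nonempty)
  then show "lead p \<in> keys p" "lex_key (lead p) = Max (lex_key ` keys p)"
    unfolding lead_def by (auto intro: inv_into_into f_inv_into_f)
qed

lemma lex_key_le_lead: "m \<in> keys p \<Longrightarrow> lex_key m \<le> lex_key (lead p)"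
  by (metis Max_ge finite_imageI finite_keys image_eqI in_keys_iff lex_key_lead lookup_zero)

lemma lead_eqI:
  assumes "m \<in> keys p" "\<And>k. k \<in> keys p \<Longrightarrow> lex_key k \<le> lex_key m"
  shows "lead p = m"
  by (metis assms antisym empty_iff keys_zero lead_in_keys lex_key_inject lex_key_le_lead)

text \<open>Addition is strictly monotone on keys: two monomials bounded by the leading ones add up
  to the sum of the leading ones only if they are the leading ones. So one pair of terms meets the
  top monomial and nothing can cancel it, which is why products of nonzero polynomials are
  nonzero.\<close>

lemma lookup_mult_lead:
  fixes p q :: "('n::finite, 'a::idom) mpoly"
  shows "lookup (p * q) (lead p + lead q) = lookup p (lead p) * lookup q (lead q)"
proof -
  have "a = lead p \<and> b = lead q"
    if "a \<in> keys p" "b \<in> keys q" "a + b = lead p + lead q" for a b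
  proof -
    have "lex_key a + lex_key b = lex_key (lead p) + lex_key (lead q)"
      using that by (metis lex_key_add)
    moreover have "lex_key a \<le> lex_key (lead p)" "lex_key b \<le> lex_key (lead q)"
      using that by (auto intro: lex_key_le_lead)
    ultimately have "lex_key a = lex_key (lead p)"
      by (metis add_le_less_mono add_less_le_mono order_less_irrefl order_le_less)
    then show ?thesis using that by auto
  qed
  then have "lookup (p * q) (lead p + lead q) =
      (\<Sum>a\<in>keys p. \<Sum>b\<in>keys q. if a = lead p \<and> b = lead q then lookup p a * lookup q b else 0)"
    unfolding lookup_mult_keys by (intro sum.cong refl) auto
  also have "\<dots> = (\<Sum>a\<in>keys p. if a = lead p then \<Sum>b\<in>keys q. if b = lead q then lookup p a * lookup q b else 0 else 0)"
    by (intro sum.cong refl) auto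
  also have "\<dots> = lookup p (lead p) * lookup q (lead q)"
    by (auto simp: in_keys_iff)
  finally show ?thesis .
qed

lemma mpoly_mult_eq_0_iff [simp]:
  fixes p q :: "('n::finite, 'a::idom) mpoly"
  shows "p * q = 0 \<longleftrightarrow> p = 0 \<or> q = 0"
proof
  assume "p * q = 0"
  then have "lookup p (lead p) * lookup q (lead q) = 0"
    using lookup_mult_lead[of p q] by simp
  then show "p = 0 \<or> q = 0"
    using lead_in_keys[of p] lead_in_keys[of q] by (auto simp: in_keys_iff)
qed auto

lemma mpoly_power_eq_0_iff [simp]:
  fixes p :: "('n::finite, 'a::idom) mpoly"
  shows "p ^ e = 0 \<longleftrightarrow> p = 0 \<and> e > 0"
  by (induction e) auto

lemma mpoly_mult_cancel_left:
  fixes p q r :: "('n::finite, 'a::idom) mpoly"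
  shows "p \<noteq> 0 \<Longrightarrow> p * q = p * r \<longleftrightarrow> q = r"
  using mpoly_mult_eq_0_iff[of p "q - r"] by (auto simp: right_diff_distrib')

lemma mpoly_dvd_mult_cancel_left:
  fixes p q r :: "('n::finite, 'a::idom) mpoly"
  shows "p \<noteq> 0 \<Longrightarrow> p * q dvd p * r \<longleftrightarrow> q dvd r"
  by (simp add: dvd_def mult.assoc mpoly_mult_cancel_left)

lemma lead_mult:
  fixes p q :: "('n::finite, 'a::idom) mpoly"
  assumes "p \<noteq> 0" "q \<noteq> 0"
  shows "lead (p * q) = lead p + lead q"
proof (rule lead_eqI)
  show "lead p + lead q \<in> keys (p * q)"
    using assms lead_in_keys[of p] lead_in_keys[of q] by (simp add: in_keys_iff lookup_mult_lead)
next
  fix k assume "k \<in> keys (p * q)"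
  then obtain a b where "a \<in> keys p" "b \<in> keys q" "k = a + b"
    using keys_mult by blast
  then show "lex_key k \<le> lex_key (lead p + lead q)"
    by (simp add: lex_key_add add_mono lex_key_le_lead)
qed

section \<open>Weighted degrees, homogeneous polynomials and homogeneous components\<close>

lemma wdeg_add: "wdeg w (\<alpha> + \<beta>) = wdeg w \<alpha> + wdeg w \<beta>"
  by (simp add: wdeg_def lookup_add algebra_simps sum.distrib)

lemma wdeg_zero [simp]: "wdeg w 0 = 0"
  by (simp add: wdeg_def)

lemma wdeg_single [simp]: "wdeg w (single i c) = w i * int c"
proof -
  have "wdeg w (single i c) = (\<Sum>j\<in>UNIV. if j = i then w i * int c else 0)"
    unfolding wdeg_def by (intro sum.cong) (auto simp: lookup_single when_def)
  then show ?thesis by simp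
qed

lemma wdeg_uminus: "wdeg (\<lambda>i. - w i) \<alpha> = - wdeg w \<alpha>"
  by (simp add: wdeg_def sum_negf)

lemma wdeg_nonneg: "(\<And>i. w i \<ge> 0) \<Longrightarrow> wdeg w \<alpha> \<ge> 0"
  by (auto simp: wdeg_def intro: sum_nonneg)

lemma whomog_zero [simp]: "whomog w d 0"
  by (simp add: whomog_def)

lemma whomog_add: "whomog w d p \<Longrightarrow> whomog w d q \<Longrightarrow> whomog w d (p + q)"
  using Poly_Mapping.keys_add[of p q] by (auto simp: whomog_def)

lemma whomog_sum: "(\<And>i. i \<in> I \<Longrightarrow> whomog w d (f i)) \<Longrightarrow> whomog w d (sum f I)"
  by (induction I rule: infinite_finite_induct) (auto intro: whomog_add)

lemma whomog_mult: "whomog w d p \<Longrightarrow> whomog w e q \<Longrightarrow> whomog w (d + e) (p * q)"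
  using keys_mult[of p q] by (fastforce simp: whomog_def wdeg_add)

lemma whomog_one [simp]: "whomog w 0 (1 :: ('n::finite, 'a::comm_ring_1) mpoly)"
  by (simp add: whomog_def)

lemma whomog_power: "whomog w d p \<Longrightarrow> whomog w (int e * d) (p ^ e :: ('n::finite, 'a::comm_ring_1) mpoly)"
proof (induction e)
  case (Suc e)
  then show ?case using whomog_mult[of w d p "int e * d" "p ^ e"] by (simp add: algebra_simps)
qed simp

lemma whomog_single: "whomog w (wdeg w m) (single m c)"
  by (auto simp: whomog_def)

lemma whomog_scale: "whomog w d p \<Longrightarrow> whomog w d (single 0 c * p)"
  using whomog_mult[OF whomog_single[of w 0 c]] by simp

lemma whomog_unique: "whomog w d p \<Longrightarrow> whomog w e p \<Longrightarrow> p \<noteq> 0 \<Longrightarrow> d = e"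
  using keys_nonempty by (fastforce simp: whomog_def)

definition hcomp :: "('n::finite \<Rightarrow> int) \<Rightarrow> int \<Rightarrow> ('n, 'a::comm_monoid_add) mpoly \<Rightarrow> ('n, 'a) mpoly" where
  "hcomp w d p = (\<Sum>m\<in>{m\<in>keys p. wdeg w m = d}. single m (lookup p m))"

lemma lookup_hcomp: "lookup (hcomp w d p) m = (if wdeg w m = d then lookup p m else 0)"
proof -
  have "lookup (hcomp w d p) m = (\<Sum>k\<in>{k\<in>keys p. wdeg w k = d}. if m = k then lookup p k else 0)"
    by (simp add: hcomp_def lookup_sum lookup_single when_def eq_commute)
  then show ?thesis by (auto simp: in_keys_iff)
qed

lemma keys_hcomp: "keys (hcomp w d p) = {m \<in> keys p. wdeg w m = d}"
  by (auto simp: in_keys_iff lookup_hcomp split: if_splits)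

lemma whomog_hcomp: "whomog w d (hcomp w d p)"
  by (auto simp: whomog_def keys_hcomp)

lemma keys_minus_hcomp:
  "keys (p - hcomp w d p) = {m \<in> keys p. wdeg w m \<noteq> d}" for p :: "('n::finite, 'a::ab_group_add) mpoly"
  by (auto simp: in_keys_iff lookup_hcomp lookup_minus split: if_splits)

text \<open>Multiplication by \<open>f\<close> raises every degree by exactly \<open>a\<close>, so
  the part of \<open>p\<close> outside degree \<open>d\<close> contributes nothing in degree
  \<open>a + d\<close>.\<close>

lemma hcomp_mult_whomog:
  fixes p f :: "('n::finite, 'a::comm_ring_1) mpoly"
  assumes "whomog w a f"
  shows "hcomp w (a + d) (f * p) = f * hcomp w d p"
proof (rule poly_mapping_eqI)
  fix k
  let ?q = "p - hcomp w d p"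
  have "lookup (f * ?q) k = 0" if "wdeg w k = a + d"
  proof (rule ccontr)
    assume "lookup (f * ?q) k \<noteq> 0"
    then obtain b c where "b \<in> keys f" "c \<in> keys ?q" "k = b + c"
      using keys_mult[of f ?q] by (auto simp: in_keys_iff)
    then show False
      using that assms unfolding keys_minus_hcomp by (auto simp: whomog_def wdeg_add)
  qed
  moreover have "lookup (f * hcomp w d p) k = 0" if "wdeg w k \<noteq> a + d"
    using that whomog_mult[OF assms whomog_hcomp[of w d p]] by (auto simp: whomog_def in_keys_iff)
  moreover have "lookup (f * p) k = lookup (f * hcomp w d p) k + lookup (f * ?q) k"
    by (simp flip: lookup_add distrib_left)
  ultimately show "lookup (hcomp w (a + d) (f * p)) k = lookup (f * hcomp w d p) k"
    by (simp add: lookup_hcomp)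
qed

text \<open>Weights of either sign are allowed, so one notion covers several degrees: weights 1 give
  the total degree, \<open>var_weight x\<close> the degree in \<open>x\<close>, and the weights -w
  the negative of the lowest degree. The value at 0 is unspecified.\<close>

definition maxdeg :: "('n::finite \<Rightarrow> int) \<Rightarrow> ('n, 'a::zero) mpoly \<Rightarrow> int" where
  "maxdeg w p = Max (wdeg w ` keys p)"

lemma wdeg_le_maxdeg: "m \<in> keys p \<Longrightarrow> wdeg w m \<le> maxdeg w p"
  by (simp add: maxdeg_def)

lemma maxdeg_attained:
  assumes "p \<noteq> 0" obtains m where "m \<in> keys p" "wdeg w m = maxdeg w p"
proof -
  have "Max (wdeg w ` keys p) \<in> wdeg w ` keys p"
    using assms by (intro Max_in) (auto dest: keys_nonempty)
  then show ?thesis using that by (auto simp: maxdeg_def)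
qed

lemma hcomp_maxdeg_nonzero: "p \<noteq> 0 \<Longrightarrow> hcomp w (maxdeg w p) p \<noteq> 0"
  by (metis (mono_tags, lifting) empty_iff keys_hcomp keys_zero maxdeg_attained mem_Collect_eq)

text \<open>Terms of \<open>p\<close> below its top degree cannot reach the sum of the two top
  degrees, so \<open>p\<close> may be replaced by its top form; what remains is a product with a
  homogeneous factor.\<close>

lemma hcomp_maxdeg_mult:
  fixes p q :: "('n::finite, 'a::comm_ring_1) mpoly"
  shows "hcomp w (maxdeg w p + maxdeg w q) (p * q) = hcomp w (maxdeg w p) p * hcomp w (maxdeg w q) q"
proof (rule poly_mapping_eqI)
  fix k
  let ?P = "hcomp w (maxdeg w p) p" and ?Q = "hcomp w (maxdeg w q) q"
  let ?d = "maxdeg w p + maxdeg w q"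
  have "lookup ((p - ?P) * q) k = 0" if "wdeg w k = ?d"
  proof (rule ccontr)
    assume "lookup ((p - ?P) * q) k \<noteq> 0"
    then obtain b c where "b \<in> keys (p - ?P)" "c \<in> keys q" "k = b + c"
      using keys_mult[of "p - ?P" q] by (auto simp: in_keys_iff)
    then show False
      using that wdeg_le_maxdeg[of b p w] wdeg_le_maxdeg[of c q w]
      unfolding keys_minus_hcomp by (auto simp: wdeg_add)
  qed
  moreover have "lookup (p * q) k = lookup (?P * q) k + lookup ((p - ?P) * q) k"
    by (simp flip: lookup_add distrib_right)
  ultimately have "lookup (hcomp w ?d (p * q)) k = lookup (hcomp w ?d (?P * q)) k"
    by (simp add: lookup_hcomp)
  then show "lookup (hcomp w ?d (p * q)) k = lookup (?P * ?Q) k"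
    by (simp add: hcomp_mult_whomog[OF whomog_hcomp])
qed

text \<open>The lower bound carries the content: the product of the two top forms is nonzero because
  there are no zero divisors.\<close>

lemma maxdeg_mult:
  fixes p q :: "('n::finite, 'a::idom) mpoly"
  assumes "p \<noteq> 0" "q \<noteq> 0"
  shows "maxdeg w (p * q) = maxdeg w p + maxdeg w q"
proof (rule antisym)
  obtain k where "k \<in> keys (p * q)" "wdeg w k = maxdeg w (p * q)"
    using assms maxdeg_attained[of "p * q"] by auto
  then obtain b c where "b \<in> keys p" "c \<in> keys q" "maxdeg w (p * q) = wdeg w b + wdeg w c"
    using keys_mult[of p q] by (force simp: wdeg_add)
  then show "maxdeg w (p * q) \<le> maxdeg w p + maxdeg w q"
    by (simp add: add_mono wdeg_le_maxdeg)
next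
  have "hcomp w (maxdeg w p + maxdeg w q) (p * q) \<noteq> 0"
    using assms by (simp add: hcomp_maxdeg_mult hcomp_maxdeg_nonzero)
  then obtain k where "k \<in> keys (p * q)" "wdeg w k = maxdeg w p + maxdeg w q"
    using keys_nonempty keys_hcomp by blast
  then show "maxdeg w p + maxdeg w q \<le> maxdeg w (p * q)"
    by (metis wdeg_le_maxdeg)
qed

lemma maxdeg_eq_whomog: "whomog w d p \<Longrightarrow> p \<noteq> 0 \<Longrightarrow> maxdeg w p = d"
  by (metis maxdeg_attained whomog_def)

lemma maxdeg_nonneg: "p \<noteq> 0 \<Longrightarrow> (\<And>i. w i \<ge> 0) \<Longrightarrow> maxdeg w p \<ge> 0"
  by (metis maxdeg_attained wdeg_nonneg)

lemma maxdeg_uminus_ge: "p \<noteq> 0 \<Longrightarrow> maxdeg (\<lambda>i. - w i) p \<ge> - maxdeg w p"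
  by (metis maxdeg_attained wdeg_le_maxdeg wdeg_uminus)

lemma whomog_maxdegI:
  assumes "maxdeg (\<lambda>i. - w i) p = - maxdeg w p"
  shows "whomog w (maxdeg w p) p"
  unfolding whomog_def
proof
  fix m assume "m \<in> keys p"
  then have "wdeg w m \<le> maxdeg w p" "- wdeg w m \<le> - maxdeg w p"
    using wdeg_le_maxdeg[of m p w] wdeg_le_maxdeg[of m p "\<lambda>i. - w i"] assms by (auto simp: wdeg_uminus)
  then show "wdeg w m = maxdeg w p" by simp
qed

text \<open>The degrees of top and bottom forms both add up in a product, so neither factor has room
  for two different degrees.\<close>

lemma whomog_factor:
  fixes p q :: "('n::finite, 'a::idom) mpoly"
  assumes "whomog w d (p * q)" "p * q \<noteq> 0"
  shows "whomog w (maxdeg w p) p"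
proof (rule whomog_maxdegI)
  let ?v = "\<lambda>i. - w i"
  have nz: "p \<noteq> 0" "q \<noteq> 0" using assms(2) by auto
  have "whomog ?v (- d) (p * q)"
    using assms(1) by (simp add: whomog_def wdeg_uminus)
  then have "maxdeg ?v p + maxdeg ?v q = - d"
    using assms(2) maxdeg_mult[OF nz, of ?v] by (simp add: maxdeg_eq_whomog)
  moreover have "maxdeg w p + maxdeg w q = d"
    using assms maxdeg_mult[OF nz, of w] by (simp add: maxdeg_eq_whomog)
  ultimately show "maxdeg ?v p = - maxdeg w p"
    using maxdeg_uminus_ge[OF nz(1), of w] maxdeg_uminus_ge[OF nz(2), of w] by linarith
qed

section \<open>Total degree, units and irreducible divisors\<close>

abbreviation tdeg :: "('n::finite, 'a::zero) mpoly \<Rightarrow> int" where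
  "tdeg \<equiv> maxdeg (\<lambda>_. 1)"

lemma wdeg_pos_eq_0_iff:
  assumes "\<And>i. w i > 0" shows "wdeg w m = 0 \<longleftrightarrow> m = 0"
proof
  assume "wdeg w m = 0"
  then have "w i * int (lookup m i) = 0" for i
    unfolding wdeg_def using assms
    by (subst (asm) sum_nonneg_eq_0_iff) (auto simp: less_imp_le)
  then show "m = 0"
    using assms by (intro poly_mapping_eqI) (simp add: less_imp_neq[symmetric])
qed simp

lemma maxdeg_pos_eq_0_imp_const:
  assumes "maxdeg w p = 0" "\<And>i. w i > 0"
  shows "p = single 0 (lookup p 0)"
proof (rule poly_mapping_eqI)
  fix k
  show "lookup p k = lookup (single 0 (lookup p 0)) k"
  proof (cases "k \<in> keys p")
    case True
    then have "wdeg w k = 0"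
      using wdeg_le_maxdeg[of k p w] wdeg_nonneg[of w k, OF less_imp_le[OF assms(2)]] assms(1)
      by linarith
    then have "k = 0" using wdeg_pos_eq_0_iff[of w k] assms(2) by blast
    then show ?thesis by simp
  qed (auto simp: in_keys_iff lookup_single when_def)
qed

lemma mpoly_unit_iff:
  fixes p :: "('n::finite, 'a::field) mpoly"
  shows "p dvd 1 \<longleftrightarrow> p \<noteq> 0 \<and> tdeg p = 0"
proof
  assume "p dvd 1"
  then obtain q where q: "1 = p * q" by auto
  then have nz: "p \<noteq> 0" "q \<noteq> 0" by auto
  have "tdeg (1 :: ('n, 'a) mpoly) = 0"
    by (rule maxdeg_eq_whomog) auto
  then have "tdeg p + tdeg q = 0"
    using maxdeg_mult[OF nz, of "\<lambda>_. 1"] by (simp flip: q)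
  then show "p \<noteq> 0 \<and> tdeg p = 0"
    using maxdeg_nonneg[OF nz(1), of "\<lambda>_. 1"] maxdeg_nonneg[OF nz(2), of "\<lambda>_. 1"] nz by simp
next
  assume *: "p \<noteq> 0 \<and> tdeg p = 0"
  then have eq: "p = single 0 (lookup p 0)"
    by (intro maxdeg_pos_eq_0_imp_const) auto
  then have "lookup p 0 \<noteq> 0" using * by (metis single_zero)
  then have "p * single 0 (inverse (lookup p 0)) = 1"
    by (subst eq) (simp add: mult_single)
  then show "p dvd 1" by (metis dvd_triv_left)
qed

lemma mpoly_unitE:
  fixes p :: "('n::finite, 'a::field) mpoly"
  assumes "p dvd 1" obtains c where "c \<noteq> 0" "p = single 0 c"
proof
  show eq: "p = single 0 (lookup p 0)"
    using assms by (intro maxdeg_pos_eq_0_imp_const) (auto simp: mpoly_unit_iff)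
  then show "lookup p 0 \<noteq> 0" using assms by (metis mpoly_unit_iff single_zero)
qed

lemma mpoly_irreducible_divisor:
  fixes p :: "('n::finite, 'a::field) mpoly"
  assumes "p \<noteq> 0" "\<not> p dvd 1"
  obtains q where "irreducible q" "q dvd p"
proof -
  have "\<exists>q. irreducible q \<and> q dvd p"
    using assms
  proof (induction "nat (tdeg p)" arbitrary: p rule: less_induct)
    case less
    show ?case
    proof (cases "irreducible p")
      case False
      then obtain a b where ab: "p = a * b" "\<not> a dvd 1" "\<not> b dvd 1"
        using less.prems by (auto simp: irreducible_def)
      then have nz: "a \<noteq> 0" "b \<noteq> 0" using less.prems by auto
      have "tdeg b > 0" "tdeg a \<ge> 0"
        using ab nz maxdeg_nonneg[of b "\<lambda>_. 1"] maxdeg_nonneg[of a "\<lambda>_. 1"]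
        by (auto simp: mpoly_unit_iff order_le_less)
      then have "nat (tdeg a) < nat (tdeg p)"
        using maxdeg_mult[OF nz, of "\<lambda>_. 1"] ab by simp
      then obtain q where "irreducible q" "q dvd a" using less.hyps nz ab by blast
      then show ?thesis using ab by auto
    qed auto
  qed
  then show ?thesis using that by auto
qed

section \<open>Irreducible polynomials are prime\<close>

text \<open>The subring K[A] as a subset of one fixed polynomial type: an induction on the variables
  can then enlarge \<open>A\<close> without changing types.\<close>

definition polys_in :: "'n set \<Rightarrow> ('n::finite, 'a::comm_ring_1) mpoly set" where
  "polys_in A = {p. \<forall>m\<in>keys p. keys m \<subseteq> A}"

lemma polys_in_UNIV [simp]: "p \<in> polys_in UNIV"
  by (simp add: polys_in_def)

lemma polys_in_mono: "A \<subseteq> B \<Longrightarrow> p \<in> polys_in A \<Longrightarrow> p \<in> polys_in B"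
  by (auto simp: polys_in_def)

lemma polys_in_zero [simp]: "0 \<in> polys_in A"
  and polys_in_one [simp]: "1 \<in> polys_in A"
  by (auto simp: polys_in_def)

lemma polys_in_single: "keys m \<subseteq> A \<Longrightarrow> single m c \<in> polys_in A"
  by (auto simp: polys_in_def)

lemma polys_in_add: "p \<in> polys_in A \<Longrightarrow> q \<in> polys_in A \<Longrightarrow> p + q \<in> polys_in A"
  using Poly_Mapping.keys_add[of p q] by (auto simp: polys_in_def)

lemma polys_in_uminus: "p \<in> polys_in A \<Longrightarrow> - p \<in> polys_in A"
  by (auto simp: polys_in_def in_keys_iff)

lemma polys_in_diff: "p \<in> polys_in A \<Longrightarrow> q \<in> polys_in A \<Longrightarrow> p - q \<in> polys_in A"
  using polys_in_add[OF _ polys_in_uminus] by fastforce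

lemma polys_in_sum: "(\<And>i. i \<in> I \<Longrightarrow> f i \<in> polys_in A) \<Longrightarrow> sum f I \<in> polys_in A"
  by (induction I rule: infinite_finite_induct) (auto intro: polys_in_add)

lemma polys_in_mult: "p \<in> polys_in A \<Longrightarrow> q \<in> polys_in A \<Longrightarrow> p * q \<in> polys_in A"
  unfolding polys_in_def
proof (intro CollectI ballI)
  fix m assume *: "p \<in> {p. \<forall>m\<in>keys p. keys m \<subseteq> A}" "q \<in> {p. \<forall>m\<in>keys p. keys m \<subseteq> A}"
    and "m \<in> keys (p * q)"
  then obtain a b where "a \<in> keys p" "b \<in> keys q" "m = a + b"
    using keys_mult by blast
  then show "keys m \<subseteq> A"
    using * Poly_Mapping.keys_add[of a b] by blast
qed

lemma polys_in_lookup: "p \<in> polys_in A \<Longrightarrow> m \<in> keys p \<Longrightarrow> y \<notin> A \<Longrightarrow> lookup m y = 0"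
  by (auto simp: polys_in_def subset_iff simp flip: not_in_keys_iff_lookup_eq_zero)

lemmas polys_in_intros = polys_in_add polys_in_diff polys_in_mult polys_in_zero polys_in_one

section \<open>Degree and leading coefficient in one variable\<close>

abbreviation var_weight :: "'n \<Rightarrow> 'n \<Rightarrow> int" where
  "var_weight x \<equiv> \<lambda>i. if i = x then 1 else 0"

lemma wdeg_var_weight: "wdeg (var_weight x) m = int (lookup m x)"
proof -
  have "wdeg (var_weight x) m = (\<Sum>i\<in>UNIV. if i = x then int (lookup m i) else 0)"
    unfolding wdeg_def by (intro sum.cong) auto
  then show ?thesis by simp
qed

lemma polys_in_iff_maxdeg:
  assumes "p \<noteq> 0"
  shows "p \<in> polys_in A \<longleftrightarrow> (\<forall>y. y \<notin> A \<longrightarrow> maxdeg (var_weight y) p = 0)"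
proof safe
  fix y assume "p \<in> polys_in A" "y \<notin> A"
  obtain m where "m \<in> keys p" "wdeg (var_weight y) m = maxdeg (var_weight y) p"
    using maxdeg_attained[OF assms] by blast
  moreover have "lookup m y = 0"
    using \<open>m \<in> keys p\<close> \<open>p \<in> polys_in A\<close> \<open>y \<notin> A\<close> by (simp add: polys_in_lookup)
  ultimately show "maxdeg (var_weight y) p = 0"
    unfolding wdeg_var_weight by simp
next
  assume *: "\<forall>y. y \<notin> A \<longrightarrow> maxdeg (var_weight y) p = 0"
  have "lookup m y = 0" if "m \<in> keys p" "y \<notin> A" for m y
    using wdeg_le_maxdeg[OF that(1), of "var_weight y"] * that(2) unfolding wdeg_var_weight by simp
  then show "p \<in> polys_in A"
    by (auto simp: polys_in_def in_keys_iff)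
qed

text \<open>The degree in a variable outside \<open>A\<close> is additive and nonnegative, so it
  vanishes on a factor when it vanishes on the product.\<close>

lemma polys_in_factor:
  fixes p q :: "('n::finite, 'a::idom) mpoly"
  assumes "p * q \<in> polys_in A" "p * q \<noteq> 0"
  shows "p \<in> polys_in A"
proof -
  have nz: "p \<noteq> 0" "q \<noteq> 0" using assms(2) by auto
  have "maxdeg (var_weight y) p = 0" if "y \<notin> A" for y
  proof -
    have "maxdeg (var_weight y) p + maxdeg (var_weight y) q = 0"
      using assms(1) that polys_in_iff_maxdeg[OF assms(2), of A] maxdeg_mult[OF nz] by simp
    moreover have "0 \<le> maxdeg (var_weight y) p" "0 \<le> maxdeg (var_weight y) q"
      using nz by (auto intro: maxdeg_nonneg)
    ultimately show ?thesis by simp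
  qed
  then show ?thesis using polys_in_iff_maxdeg[OF nz(1)] by blast
qed

lemma polys_in_dvd:
  fixes p q :: "('n::finite, 'a::idom) mpoly"
  shows "p dvd q \<Longrightarrow> q \<in> polys_in A \<Longrightarrow> q \<noteq> 0 \<Longrightarrow> p \<in> polys_in A"
  using polys_in_factor by (metis dvdE)

lemma unit_in_polys_in:
  fixes p :: "('n::finite, 'a::field) mpoly"
  shows "p dvd 1 \<Longrightarrow> p \<in> polys_in A"
  by (rule polys_in_dvd) auto

text \<open>One more than the degree in \<open>x\<close>, with 0 for the zero polynomial: removing
  the leading term in \<open>x\<close> always makes it drop, even when nothing is left.\<close>

definition xsize :: "'n \<Rightarrow> ('n, 'a::zero) mpoly \<Rightarrow> nat" where
  "xsize x p = Max (insert 0 ((\<lambda>m. Suc (lookup m x)) ` keys p))"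

lemma xsize_le_iff: "xsize x p \<le> n \<longleftrightarrow> (\<forall>m\<in>keys p. lookup m x < n)"
  by (auto simp: xsize_def Suc_le_eq)

abbreviation xpow :: "'n \<Rightarrow> nat \<Rightarrow> ('n, 'a::comm_ring_1) mpoly" where
  "xpow x d \<equiv> single (single x d) 1"

lemma xpow_mult: "xpow x d * xpow x e = xpow x (d + e)"
  by (simp add: mult_single single_add)

lemma xpow_nonzero [simp]: "xpow x d \<noteq> 0"
  by (metis lookup_single_eq lookup_zero zero_neq_one)

lemma factor_out_xpow:
  fixes p :: "('n::finite, 'a::comm_ring_1) mpoly"
  assumes "\<And>m. m \<in> keys p \<Longrightarrow> lookup m x = d" "p \<in> polys_in (insert x A)"
  obtains l where "p = xpow x d * l" "l \<in> polys_in A"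
proof
  let ?l = "\<Sum>m\<in>keys p. single (m - single x d) (lookup p m)"
  have "single x d + (m - single x d) = m" if "m \<in> keys p" for m
    using assms(1)[OF that] by (intro poly_mapping_eqI) (auto simp: lookup_add lookup_minus lookup_single when_def)
  then have "xpow x d * ?l = (\<Sum>m\<in>keys p. single m (lookup p m))"
    by (simp add: sum_distrib_left mult_single)
  then show "p = xpow x d * ?l"
    using poly_mapping_sum_singles[of p] by simp
  show "?l \<in> polys_in A"
  proof (intro polys_in_sum polys_in_single)
    fix m assume m: "m \<in> keys p"
    have "keys m \<subseteq> insert x A" using m assms(2) by (auto simp: polys_in_def)
    show "keys (m - single x d) \<subseteq> A"
    proof
      fix y assume "y \<in> keys (m - single x d)"
      then have y: "lookup m y - lookup (single x d) y \<noteq> 0"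
        by (simp add: in_keys_iff lookup_minus)
      then have "y \<noteq> x" using assms(1)[OF m] by auto
      moreover have "y \<in> keys m" using y by (auto simp: in_keys_iff)
      ultimately show "y \<in> A" using \<open>keys m \<subseteq> insert x A\<close> by blast
    qed
  qed
qed

text \<open>The view of \<open>p\<close> as a polynomial in \<open>x\<close> over K[A]:
  \<open>l\<close> is its leading coefficient and \<open>p0\<close> the rest.\<close>

lemma lead_coeff_in_var:
  fixes p :: "('n::finite, 'a::comm_ring_1) mpoly"
  assumes "p \<noteq> 0" "p \<in> polys_in (insert x A)"
  obtains d l p0 where "maxdeg (var_weight x) p = int d" "xsize x p = Suc d"
    "hcomp (var_weight x) (int d) p = xpow x d * l" "l \<in> polys_in A" "l \<noteq> 0"
    "p = xpow x d * l + p0" "xsize x p0 \<le> d" "p0 \<in> polys_in (insert x A)"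
proof -
  let ?w = "var_weight x"
  define d where "d = nat (maxdeg ?w p)"
  have d: "maxdeg ?w p = int d"
    using maxdeg_nonneg[OF assms(1), of ?w] by (simp add: d_def)
  let ?P = "hcomp ?w (int d) p"
  have le: "lookup m x \<le> d" if "m \<in> keys p" for m
    using wdeg_le_maxdeg[OF that, of ?w] unfolding wdeg_var_weight d by simp
  obtain m where m: "m \<in> keys p" "lookup m x = d"
    using maxdeg_attained[OF assms(1), of ?w] unfolding d wdeg_var_weight by auto
  have size: "xsize x p = Suc d"
    using le m by (intro antisym) (fastforce simp: xsize_le_iff, auto simp: xsize_def)
  have keysP: "keys ?P \<subseteq> keys p" "keys (p - ?P) \<subseteq> keys p"
    by (auto simp: keys_hcomp keys_minus_hcomp)
  obtain l where l: "?P = xpow x d * l" "l \<in> polys_in A"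
  proof (rule factor_out_xpow)
    show "lookup m x = d" if "m \<in> keys ?P" for m
      using that unfolding keys_hcomp wdeg_var_weight by simp
    show "?P \<in> polys_in (insert x A)"
      using keysP assms(2) by (auto simp: polys_in_def)
  qed
  show ?thesis
  proof (rule that[OF d size l])
    show "l \<noteq> 0" using hcomp_maxdeg_nonzero[OF assms(1), of ?w] l unfolding d by auto
    show "p = xpow x d * l + (p - ?P)" using l by simp
    show "xsize x (p - ?P) \<le> d"
      using le unfolding xsize_le_iff keys_minus_hcomp wdeg_var_weight by fastforce
    show "p - ?P \<in> polys_in (insert x A)"
      using keysP assms(2) by (auto simp: polys_in_def)
  qed
qed

lemma whomog_var_weight_polys_in: "x \<notin> A \<Longrightarrow> p \<in> polys_in A \<Longrightarrow> whomog (var_weight x) 0 p"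
  unfolding whomog_def wdeg_var_weight by (simp add: polys_in_lookup)

text \<open>Both \<open>f\<close> and \<open>xpow x e * t\<close> are homogeneous in
  \<open>x\<close>, of degrees 0 and \<open>e\<close>, so the cofactor is homogeneous of degree
  \<open>e\<close>, hence itself a multiple of \<open>xpow x e\<close>, which cancels.\<close>

lemma dvd_xpow_mult_cancel:
  fixes f t :: "('n::finite, 'a::idom) mpoly"
  assumes "x \<notin> A" "f \<in> polys_in A" "f dvd xpow x e * t" "t \<noteq> 0" "t \<in> polys_in A"
  shows "f dvd t"
proof -
  let ?w = "var_weight x"
  obtain s where s: "xpow x e * t = f * s" using assms(3) by auto
  have nz: "f * s \<noteq> 0" using assms(4) by (simp flip: s)
  then have nz': "f \<noteq> 0" "s \<noteq> 0" by auto
  have "whomog ?w (int e) (xpow x e * t)"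
    using whomog_mult[OF whomog_single[of ?w "single x e"] whomog_var_weight_polys_in[OF assms(1,5)]] by simp
  then have hom: "whomog ?w (int e) (s * f)" using s by (metis mult.commute)
  then have "maxdeg ?w s + maxdeg ?w f = int e"
    using nz maxdeg_mult[OF nz'(2,1), of ?w] maxdeg_eq_whomog[of ?w "int e" "s * f"] by (simp add: mult.commute)
  moreover have "maxdeg ?w f = 0"
    using nz'(1) whomog_var_weight_polys_in[OF assms(1,2)] by (intro maxdeg_eq_whomog)
  ultimately have "whomog ?w (int e) s"
    using whomog_factor[OF hom] nz by (simp add: mult.commute)
  then have "lookup m x = e" if "m \<in> keys s" for m
    using that unfolding whomog_def wdeg_var_weight by simp
  moreover have "s \<in> polys_in (insert x UNIV)" by simp
  ultimately obtain l where "s = xpow x e * l"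
    by (rule factor_out_xpow)
  then have "xpow x e * t = xpow x e * (f * l)" using s by (simp only: mult_ac)
  then show ?thesis by (simp add: mpoly_mult_cancel_left)
qed

text \<open>Primality is tested on factors from \<open>R\<close>, while divisibility is that of the
  whole ring. For \<open>R = polys_in A\<close> and \<open>f\<close> in K[A] this is primality in
  K[A], since by \<open>polys_in_dvd\<close> the divisors of a nonzero element of K[A] lie in
  K[A].\<close>

definition prime_on :: "'b::comm_semiring_1 set \<Rightarrow> 'b \<Rightarrow> bool" where
  "prime_on R f \<longleftrightarrow> (\<forall>g\<in>R. \<forall>h\<in>R. f dvd g * h \<longrightarrow> f dvd g \<or> f dvd h)"

text \<open>A prime of K[A] stays prime in K[A][x]: it divides the product of the leading
  coefficients in \<open>x\<close>, hence one of them; removing that leading term makes one factor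
  shorter.\<close>

lemma prime_on_insert_var:
  fixes f :: "('n::finite, 'a::idom) mpoly"
  assumes "x \<notin> A" "f \<in> polys_in A" "prime_on (polys_in A) f"
  shows "prime_on (polys_in (insert x A)) f"
  unfolding prime_on_def
proof (intro ballI impI)
  fix g h :: "('n, 'a) mpoly"
  assume "g \<in> polys_in (insert x A)" "h \<in> polys_in (insert x A)" "f dvd g * h"
  then show "f dvd g \<or> f dvd h"
  proof (induction "xsize x g + xsize x h" arbitrary: g h rule: less_induct)
    case less
    let ?w = "var_weight x"
    show ?case
    proof (cases "g = 0 \<or> h = 0")
      case False
      obtain d l g0 where g: "maxdeg ?w g = int d" "xsize x g = Suc d"
        "hcomp ?w (int d) g = xpow x d * l" "l \<in> polys_in A" "l \<noteq> 0"
        "g = xpow x d * l + g0" "xsize x g0 \<le> d" "g0 \<in> polys_in (insert x A)"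
        using lead_coeff_in_var[of g x A] False less.prems by blast
      obtain d' l' h0 where h: "maxdeg ?w h = int d'" "xsize x h = Suc d'"
        "hcomp ?w (int d') h = xpow x d' * l'" "l' \<in> polys_in A" "l' \<noteq> 0"
        "h = xpow x d' * l' + h0" "xsize x h0 \<le> d'" "h0 \<in> polys_in (insert x A)"
        using lead_coeff_in_var[of h x A] False less.prems by blast
      obtain s where s: "g * h = f * s" using less.prems(3) by auto
      have "hcomp ?w (int d + int d') (g * h) = xpow x d * l * (xpow x d' * l')"
        using hcomp_maxdeg_mult[of ?w g h] g h by simp
      also have "\<dots> = xpow x (d + d') * (l * l')"
        unfolding xpow_mult[symmetric] by (simp only: mult_ac)
      finally have "f dvd xpow x (d + d') * (l * l')"
        using hcomp_mult_whomog[OF whomog_var_weight_polys_in[OF assms(1,2)], of "int d + int d'" s]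
        by (simp add: s)
      moreover have "l * l' \<noteq> 0" "l * l' \<in> polys_in A"
        using g(5) h(5) polys_in_mult[OF g(4) h(4)] by auto
      ultimately have "f dvd l * l'"
        using dvd_xpow_mult_cancel[OF assms(1,2)] by blast
      then consider "f dvd l" | "f dvd l'"
        using assms(3) g h by (auto simp: prime_on_def)
      then show ?thesis
      proof cases
        case 1
        have "g0 * h = g * h - xpow x d * l * h"
          by (subst g(6)) (simp add: algebra_simps)
        then have "f dvd g0 * h" using 1 less.prems(3) by simp
        then have "f dvd g0 \<or> f dvd h"
          using less.prems g by (intro less.hyps) auto
        then show ?thesis using 1 by (subst g(6)) auto
      next
        case 2
        have "g * h0 = g * h - xpow x d' * l' * g"
          by (subst h(6)) (simp add: algebra_simps)
        then have "f dvd g * h0" using 2 less.prems(3) by simp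
        then have "f dvd g \<or> f dvd h0"
          using less.prems h by (intro less.hyps) auto
        then show ?thesis using 2 by (subst h(6)) auto
      qed
    qed auto
  qed
qed

text \<open>This form of Gauss' lemma avoids passing to the fraction field.\<close>

lemma distribute_denominator:
  fixes c g q r :: "('n::finite, 'a::field) mpoly"
  assumes prime: "\<And>f :: ('n, 'a) mpoly. irreducible f \<Longrightarrow> f \<in> polys_in A \<Longrightarrow> prime_on (polys_in B) f"
    and "c \<in> polys_in A" "c * g = q * r" "c * g \<noteq> 0" "q \<in> polys_in B" "r \<in> polys_in B"
  shows "\<exists>c1\<in>polys_in A. \<exists>c2\<in>polys_in A. \<exists>q' r'. q = c1 * q' \<and> r = c2 * r' \<and> g = q' * r'"
  using assms(2-)
proof (induction "nat (tdeg c)" arbitrary: c q r rule: less_induct)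
  case less
  show ?case
  proof (cases "c dvd 1")
    case True
    then obtain b where b: "1 = c * b" by auto
    have "g = b * (c * g)" by (metis b mult.assoc mult.commute mult_1)
    then have "g = b * q * r" using less.prems(2) by (simp add: mult.assoc)
    moreover have "q = c * (b * q)" by (metis b mult.assoc mult_1)
    ultimately show ?thesis using less.prems(1) by (metis mult_1 polys_in_one)
  next
    case False
    have c: "c \<noteq> 0" using less.prems(3) by auto
    obtain p where p: "irreducible p" "p dvd c"
      using mpoly_irreducible_divisor[OF c False] by blast
    then obtain c' where c': "c = p * c'" by auto
    have pA: "p \<in> polys_in A" "c' \<in> polys_in A"
      using less.prems(1) c c' polys_in_factor[of p c' A] polys_in_factor[of c' p A]
      by (auto simp: mult.commute)
    have nz: "p \<noteq> 0" "c' \<noteq> 0" "g \<noteq> 0" "q \<noteq> 0" "r \<noteq> 0"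
      using c c' less.prems by auto
    have "tdeg p \<noteq> 0" using p(1) nz by (auto simp: irreducible_def mpoly_unit_iff)
    then have lt: "nat (tdeg c') < nat (tdeg c)"
      using maxdeg_mult[OF nz(1,2), of "\<lambda>_. 1"] maxdeg_nonneg[OF nz(1), of "\<lambda>_. 1"]
        maxdeg_nonneg[OF nz(2), of "\<lambda>_. 1"] by (simp add: c')
    \<comment> \<open>A prime factor of the denominator divides \<open>q\<close> or
      \<open>r\<close>; it is cancelled there and recorded in \<open>c1\<close> or
      \<open>c2\<close>, and the remaining denominator has smaller degree.\<close>
    have "p dvd q * r" using less.prems(2) c' by (metis dvd_triv_left mult.assoc)
    then consider "p dvd q" | "p dvd r"
      using prime[OF p(1) pA(1)] less.prems by (auto simp: prime_on_def)
    then show ?thesis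
    proof cases
      case 1
      then obtain q1 where q1: "q = p * q1" by auto
      have q1B: "q1 \<in> polys_in B"
        using less.prems(4) nz q1 polys_in_dvd[of q1 q B] by simp
      have "p * (c' * g) = p * (q1 * r)"
        using less.prems(2) by (simp add: c' q1 mult.assoc)
      then have "c' * g = q1 * r" using nz by (simp add: mpoly_mult_cancel_left)
      then obtain c1 c2 q' r' where "c1 \<in> polys_in A" "c2 \<in> polys_in A"
        "q1 = c1 * q'" "r = c2 * r'" "g = q' * r'"
        using less.hyps[OF lt pA(2)] q1B less.prems nz by (metis mpoly_mult_eq_0_iff)
      moreover from this have "q = p * c1 * q'" using q1 by (simp add: mult.assoc)
      ultimately show ?thesis
        using polys_in_mult[OF pA(1)] by blast
    next
      case 2
      then obtain r1 where r1: "r = p * r1" by auto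
      have r1B: "r1 \<in> polys_in B"
        using less.prems(5) nz r1 polys_in_dvd[of r1 r B] by simp
      have "p * (c' * g) = p * (q * r1)"
        using less.prems(2) by (simp add: c' r1 mult_ac)
      then have "c' * g = q * r1" using nz by (simp add: mpoly_mult_cancel_left)
      then obtain c1 c2 q' r' where "c1 \<in> polys_in A" "c2 \<in> polys_in A"
        "q = c1 * q'" "r1 = c2 * r'" "g = q' * r'"
        using less.hyps[OF lt pA(2)] r1B less.prems nz by (metis mpoly_mult_eq_0_iff)
      moreover from this have "r = p * c2 * r'" using r1 by (simp add: mult.assoc)
      ultimately show ?thesis
        using polys_in_mult[OF pA(1)] by blast
    qed
  qed
qed

text \<open>An element \<open>r\<close> of least degree in \<open>x\<close> of the ideal \<open>(f, h)\<close> is, up to denominators, a greatest common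
  divisor of \<open>f\<close> and \<open>h\<close>.\<close>

lemma prime_on_insert_of_irreducible:
  fixes f :: "('n::finite, 'a::field) mpoly"
  assumes IH: "\<And>f :: ('n, 'a) mpoly. irreducible f \<Longrightarrow> f \<in> polys_in A \<Longrightarrow> prime_on (polys_in A) f"
    and x: "x \<notin> A" and f: "irreducible f" "f \<in> polys_in (insert x A)" "f \<notin> polys_in A"
  shows "prime_on (polys_in (insert x A)) f"
  unfolding prime_on_def
proof (intro ballI impI, rule ccontr)
  let ?B = "insert x A"
  fix g h assume g: "g \<in> polys_in ?B" and h: "h \<in> polys_in ?B" and dvd: "f dvd g * h"
    and not: "\<not> (f dvd g \<or> f dvd h)"
  have AB: "p \<in> polys_in ?B" if "p \<in> polys_in A" for p :: "('n, 'a) mpoly"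
    using that by (rule polys_in_mono[rotated]) auto
  have f0: "f \<noteq> 0" using f(1) by auto
  have nz: "g \<noteq> 0" "h \<noteq> 0" using not by auto
  have prime: "prime_on (polys_in ?B) p" if "irreducible p" "p \<in> polys_in A" for p :: "('n, 'a) mpoly"
    using that IH x by (intro prime_on_insert_var) auto
  \<comment> \<open>Since \<open>f\<close> really involves \<open>x\<close>, it shares no factor
    with \<open>c\<close>: in the factorization \<open>f = c1 * q'\<close> the part
    \<open>q'\<close> cannot be a unit, so irreducibility makes \<open>c1\<close> one.\<close>
  have cancel: "f dvd p" if cp: "f dvd c * p" "c \<in> polys_in A" "c \<noteq> 0" "p \<in> polys_in ?B" "p \<noteq> 0" for c p
  proof -
    obtain t where t: "c * p = f * t" using cp(1) by auto
    have "t \<in> polys_in ?B"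
    proof (rule polys_in_dvd)
      show "t dvd c * p" using t by simp
      show "c * p \<in> polys_in ?B" using cp AB by (intro polys_in_mult) auto
      show "c * p \<noteq> 0" using cp by simp
    qed
    then obtain c1 c2 q' r' where *: "c1 \<in> polys_in A" "c2 \<in> polys_in A"
      "f = c1 * q'" "t = c2 * r'" "p = q' * r'"
      using distribute_denominator[of A ?B c p f t] prime cp t f(2)
      by (metis mpoly_mult_eq_0_iff)
    have "\<not> q' dvd 1"
      using f(3) * polys_in_mult unit_in_polys_in by blast
    then have "c1 dvd 1" using f(1) *(3) by (auto simp: irreducible_def)
    then have "f dvd q'" using *(3) mult_dvd_mono[of c1 1 q' q'] by simp
    then show ?thesis using *(5) by simp
  qed
  define J where "J = {a * f + b * h | a b. a \<in> polys_in ?B \<and> b \<in> polys_in ?B}"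
  have fJ: "f \<in> J" unfolding J_def
    by (rule CollectI, rule exI[of _ 1], rule exI[of _ 0]) auto
  have hJ: "h \<in> J" unfolding J_def
    by (rule CollectI, rule exI[of _ 0], rule exI[of _ 1]) auto
  have JB: "p \<in> polys_in ?B" if "p \<in> J" for p
    using that f(2) h by (auto simp: J_def intro!: polys_in_intros)
  have Jcomb: "a * p - b * q \<in> J"
    if pq: "p \<in> J" "q \<in> J" "a \<in> polys_in ?B" "b \<in> polys_in ?B" for a b p q
  proof -
    obtain a1 b1 a2 b2 where "p = a1 * f + b1 * h" "q = a2 * f + b2 * h"
      "a1 \<in> polys_in ?B" "b1 \<in> polys_in ?B" "a2 \<in> polys_in ?B" "b2 \<in> polys_in ?B"
      using pq by (auto simp: J_def)
    then show ?thesis unfolding J_def using pq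
      by (intro CollectI exI[of _ "a * a1 - b * a2"] exI[of _ "a * b1 - b * b2"])
        (auto simp: algebra_simps intro!: polys_in_intros)
  qed
  obtain r where r: "r \<in> J" "r \<noteq> 0" and min: "\<And>p. p \<in> J \<Longrightarrow> p \<noteq> 0 \<Longrightarrow> xsize x r \<le> xsize x p"
    using ex_has_least_nat[of "\<lambda>p. p \<in> J \<and> p \<noteq> 0" f "xsize x"] fJ f0 by blast
  obtain e k r0 where k: "xsize x r = Suc e" "k \<in> polys_in A" "k \<noteq> 0"
    "r = xpow x e * k + r0" "xsize x r0 \<le> e"
    using lead_coeff_in_var[OF r(2) JB[OF r(1)]] by metis
  \<comment> \<open>Division by \<open>r\<close> in which multiplying by the leading coefficient
    \<open>k\<close> of \<open>r\<close> replaces inverting it. By \<open>min\<close>, no nonzero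
    element of \<open>J\<close> is smaller than \<open>r\<close>, so the descent can only end at
    0.\<close>
  have pseudo_div: "\<exists>c\<in>polys_in A. \<exists>q\<in>polys_in ?B. c \<noteq> 0 \<and> c * p = q * r" if "p \<in> J" for p
    using that
  proof (induction "xsize x p" arbitrary: p rule: less_induct)
    case less
    show ?case
    proof (cases "p = 0")
      case True
      then show ?thesis by (intro bexI[of _ 1] bexI[of _ 0]) auto
    next
      case False
      obtain d l p0 where l: "xsize x p = Suc d" "l \<in> polys_in A" "l \<noteq> 0"
        "p = xpow x d * l + p0" "xsize x p0 \<le> d"
        using lead_coeff_in_var[OF False JB[OF less.prems]] by metis
      have ed: "e \<le> d" using min[OF less.prems False] l k by simp
      \<comment> \<open>Chosen so that \<open>k * p\<close> and \<open>?s * r\<close> have the same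
        leading term in \<open>x\<close>.\<close>
      let ?s = "xpow x (d - e) * l"
      have sB: "?s \<in> polys_in ?B"
        using AB[OF l(2)] by (intro polys_in_mult polys_in_single) (auto simp: in_keys_iff lookup_single when_def)
      have "?s * (xpow x e * k) = k * (xpow x d * l)"
      proof -
        have "xpow x (d - e) * xpow x e = (xpow x d :: ('n, 'a) mpoly)"
          using ed by (simp add: xpow_mult)
        then have "xpow x (d - e) * xpow x e * (l * k) = xpow x d * (l * k)" by simp
        then show ?thesis by (simp only: mult_ac)
      qed
      then have p1: "k * p - ?s * r = k * p0 - ?s * r0"
        by (subst l(4), subst k(4)) (simp add: algebra_simps)
      have "\<forall>m\<in>keys (k * p0 - ?s * r0). lookup m x < d"
      proof
        fix m assume "m \<in> keys (k * p0 - ?s * r0)"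
        then have "lookup (k * p0) m \<noteq> 0 \<or> lookup (?s * r0) m \<noteq> 0"
          by (auto simp: in_keys_iff lookup_minus)
        then consider "m \<in> keys (k * p0)" | "m \<in> keys (?s * r0)"
          unfolding in_keys_iff by blast
        then show "lookup m x < d"
        proof cases
          case 1
          then obtain a b where ab: "a \<in> keys k" "b \<in> keys p0" "m = a + b" using keys_mult by blast
          then have "lookup a x = 0" using k(2) x by (simp add: polys_in_lookup)
          then show ?thesis using ab l(5) by (simp add: lookup_add xsize_le_iff)
        next
          case 2
          then obtain a b where ab: "a \<in> keys ?s" "b \<in> keys r0" "m = a + b" using keys_mult by blast
          then obtain a' where a': "a' \<in> keys l" "a = single x (d - e) + a'"
            using keys_mult[of "xpow x (d - e)" l] by auto
          then have "lookup a x = d - e" using l(2) x by (simp add: polys_in_lookup lookup_add)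
          moreover have "lookup b x < e" using ab k(5) by (simp add: xsize_le_iff)
          ultimately show ?thesis using ab ed by (simp add: lookup_add)
        qed
      qed
      then have "xsize x (k * p - ?s * r) < xsize x p"
        unfolding p1 by (simp add: l(1) less_Suc_eq_le xsize_le_iff)
      then obtain c q where c: "c \<in> polys_in A" "q \<in> polys_in ?B" "c \<noteq> 0" "c * (k * p - ?s * r) = q * r"
        using less.hyps Jcomb[OF less.prems r(1) AB[OF k(2)] sB] by blast
      have "c * k * p = c * (k * p - ?s * r) + c * ?s * r" by (simp add: algebra_simps)
      also have "\<dots> = (q + c * ?s) * r" unfolding c(4) by (simp add: algebra_simps)
      finally have "c * k * p = (q + c * ?s) * r" .
      moreover have "q + c * ?s \<in> polys_in ?B" "c * k \<in> polys_in A"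
        using c k AB sB by (auto intro!: polys_in_intros)
      ultimately show ?thesis using c(3) k(3) by (metis mpoly_mult_eq_0_iff)
    qed
  qed
  obtain c q where c: "c \<in> polys_in A" "q \<in> polys_in ?B" "c \<noteq> 0" "c * f = q * r"
    using pseudo_div[OF fJ] by blast
  \<comment> \<open>Up to a denominator \<open>r\<close> divides \<open>f\<close>; spreading that
    denominator over \<open>q\<close> and \<open>r\<close> gives a genuine factorization of
    \<open>f\<close>, in which one factor is a unit. Either \<open>f\<close> divides
    \<open>r\<close>, hence \<open>h\<close>, or \<open>r\<close> lies in K[A], and then
    \<open>r * g\<close>, being a multiple of \<open>f\<close>, forces \<open>f\<close> to divide
    \<open>g\<close>.\<close>
  obtain c1 c2 q' r' where *: "c1 \<in> polys_in A" "c2 \<in> polys_in A" "q = c1 * q'" "r = c2 * r'" "f = q' * r'"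
    using distribute_denominator[of A ?B c f q r] prime c f0 JB[OF r(1)] by (metis mpoly_mult_eq_0_iff)
  consider "q' dvd 1" | "r' dvd 1" using irreducibleD[OF f(1) *(5)] by blast
  then show False
  proof cases
    case 1
    then have "f dvd r'" using *(5) mult_dvd_mono[of q' 1 r' r'] by simp
    then have "f dvd r" using *(4) by simp
    moreover obtain c' s where c': "c' \<in> polys_in A" "c' \<noteq> 0" "c' * h = s * r"
      using pseudo_div[OF hJ] by blast
    ultimately have "f dvd c' * h" by simp
    then show False using cancel[of c' h] c' h nz not by blast
  next
    case 2
    then have "r \<in> polys_in A"
      using * polys_in_mult unit_in_polys_in by blast
    moreover obtain a b where "r = a * f + b * h" using r(1) by (auto simp: J_def)
    then have "r * g = a * g * f + b * (g * h)" by (simp add: algebra_simps)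
    then have "f dvd r * g" using dvd by simp
    ultimately show False using cancel[of r g] r(2) g nz not by blast
  qed
qed

text \<open>Induction on the set of variables involved: an irreducible \<open>f\<close> in K[A][x]
  either lies in K[A], where primality is inherited, or involves \<open>x\<close>, where the Gauss
  argument applies. The field itself has no irreducible elements.\<close>

theorem mpoly_irreducible_prime:
  fixes f g h :: "('n::finite, 'a::field) mpoly"
  assumes "irreducible f" "f dvd g * h"
  shows "f dvd g \<or> f dvd h"
proof -
  have "prime_on (polys_in A) f" if "finite A" "irreducible f" "f \<in> polys_in A"
    for A and f :: "('n, 'a) mpoly"
    using that
  proof (induction A arbitrary: f rule: finite_induct)
    case empty
    then have "m = 0" if "m \<in> keys f" for m
      using that by (metis (mono_tags, lifting) keys_nonempty mem_Collect_eq polys_in_def subset_empty)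
    then have "whomog (\<lambda>_. 1) 0 f" using wdeg_zero by (metis whomog_def)
    then have "f dvd 1" using empty by (auto simp: mpoly_unit_iff intro: maxdeg_eq_whomog)
    then show ?case using empty by (simp add: irreducible_def)
  next
    case (insert x A)
    then show ?case
      using prime_on_insert_var[of x A f] prime_on_insert_of_irreducible[of A x f] by blast
  qed
  from this[of UNIV f] show ?thesis
    using assms by (simp add: prime_on_def)
qed

section \<open>Hilbert numerators of monomial ideals\<close>

text \<open>For the Laurent polynomial with coefficients \<open>h\<close>, \<open>r\<close> is its
  value and \<open>c\<close> its derivative at t = 1. Finite support is included because a sum over
  an infinite set is 0 by convention and would carry no information.\<close>

definition has_moments :: "(int \<Rightarrow> int) \<Rightarrow> int \<Rightarrow> int \<Rightarrow> bool" where
  "has_moments h r c \<longleftrightarrow> finite {m. h m \<noteq> 0} \<and>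
     (\<Sum>m\<in>{m. h m \<noteq> 0}. h m) = r \<and> (\<Sum>m\<in>{m. h m \<noteq> 0}. m * h m) = c"

lemma has_momentsI:
  assumes "finite F" "\<And>m. m \<notin> F \<Longrightarrow> h m = 0"
  shows "has_moments h (\<Sum>m\<in>F. h m) (\<Sum>m\<in>F. m * h m)"
proof -
  have "{m. h m \<noteq> 0} \<subseteq> F" using assms(2) by blast
  then show ?thesis
    unfolding has_moments_def using assms(1)
    by (auto intro: finite_subset intro!: sum.mono_neutral_left)
qed

lemma has_momentsE:
  assumes "has_moments h r c" "finite F" "\<And>m. h m \<noteq> 0 \<Longrightarrow> m \<in> F"
  shows "(\<Sum>m\<in>F. h m) = r" "(\<Sum>m\<in>F. m * h m) = c"
proof -
  have "(\<Sum>m\<in>F. h m) = (\<Sum>m\<in>{m. h m \<noteq> 0}. h m)" "(\<Sum>m\<in>F. m * h m) = (\<Sum>m\<in>{m. h m \<noteq> 0}. m * h m)"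
    using assms(2,3) by (auto intro!: sum.mono_neutral_right)
  then show "(\<Sum>m\<in>F. h m) = r" "(\<Sum>m\<in>F. m * h m) = c"
    using assms(1) by (auto simp: has_moments_def)
qed

lemma has_moments_zero: "has_moments (\<lambda>_. 0) 0 0"
  by (simp add: has_moments_def)

lemma has_moments_lincomb:
  assumes "has_moments h r c" "has_moments h' r' c'"
  shows "has_moments (\<lambda>m. a * h m + b * h' m) (a * r + b * r') (a * c + b * c')"
proof -
  let ?F = "{m. h m \<noteq> 0} \<union> {m. h' m \<noteq> 0}"
  have fin: "finite ?F" using assms by (simp add: has_moments_def)
  have sums: "(\<Sum>m\<in>?F. h m) = r" "(\<Sum>m\<in>?F. m * h m) = c"
    "(\<Sum>m\<in>?F. h' m) = r'" "(\<Sum>m\<in>?F. m * h' m) = c'"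
    by (auto intro!: has_momentsE[OF assms(1) fin] has_momentsE[OF assms(2) fin])
  have "(\<Sum>m\<in>?F. a * h m + b * h' m) = a * r + b * r'"
    by (simp add: sum.distrib sums flip: sum_distrib_left)
  moreover have "(\<Sum>m\<in>?F. m * (a * h m + b * h' m)) = a * (\<Sum>m\<in>?F. m * h m) + b * (\<Sum>m\<in>?F. m * h' m)"
    unfolding sum_distrib_left sum.distrib[symmetric] by (intro sum.cong) (auto simp: algebra_simps)
  ultimately show ?thesis
    using has_momentsI[OF fin, of "\<lambda>m. a * h m + b * h' m"] by (simp add: sums)
qed

lemma has_moments_add:
  "has_moments h r c \<Longrightarrow> has_moments h' r' c' \<Longrightarrow> has_moments (\<lambda>m. h m + h' m) (r + r') (c + c')"
  using has_moments_lincomb[of h r c h' r' c' 1 1] by simp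

lemma has_moments_diff:
  "has_moments h r c \<Longrightarrow> has_moments h' r' c' \<Longrightarrow> has_moments (\<lambda>m. h m - h' m) (r - r') (c - c')"
  using has_moments_lincomb[of h r c h' r' c' 1 "-1"] by simp

lemma has_moments_sum:
  assumes "finite I" "\<And>i. i \<in> I \<Longrightarrow> has_moments (h i) (r i) (c i)"
  shows "has_moments (\<lambda>m. \<Sum>i\<in>I. h i m) (\<Sum>i\<in>I. r i) (\<Sum>i\<in>I. c i)"
  using assms by (induction I rule: finite_induct) (auto intro: has_moments_zero has_moments_add)

text \<open>The product rule for t^a times the Laurent polynomial, evaluated at 1.\<close>

lemma has_moments_shift:
  assumes "has_moments h r c"
  shows "has_moments (\<lambda>m. h (m - a)) r (c + a * r)"
proof -
  let ?F = "{m. h m \<noteq> 0}"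
  have fin: "finite ((\<lambda>m. m + a) ` ?F)" using assms by (simp add: has_moments_def)
  have inj: "inj_on (\<lambda>m. m + a) ?F" by (auto intro: inj_onI)
  have "(\<Sum>m\<in>(\<lambda>m. m + a) ` ?F. h (m - a)) = r"
    using assms by (simp add: sum.reindex[OF inj] has_moments_def)
  moreover have "(\<Sum>m\<in>(\<lambda>m. m + a) ` ?F. m * h (m - a)) = (\<Sum>m\<in>?F. m * h m) + a * (\<Sum>m\<in>?F. h m)"
    by (simp add: sum.reindex[OF inj] algebra_simps sum.distrib sum_distrib_left)
  then have "(\<Sum>m\<in>(\<lambda>m. m + a) ` ?F. m * h (m - a)) = c + a * r"
    using assms by (simp add: has_moments_def)
  moreover have "h (m - a) = 0" if "m \<notin> (\<lambda>m. m + a) ` ?F" for m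
  proof (rule ccontr)
    assume "h (m - a) \<noteq> 0"
    then have "m \<in> (\<lambda>m. m + a) ` ?F" by (intro image_eqI[of _ _ "m - a"]) auto
    then show False using that by contradiction
  qed
  ultimately show ?thesis using has_momentsI[OF fin, of "\<lambda>m. h (m - a)"] by simp
qed

text \<open>The coefficients of H(t) times the product of 1 - t^(u_i) over i in \<open>B\<close>. A
  subset \<open>B\<close> of the variables is allowed so that the factors can be introduced one at a
  time.\<close>

definition num_on :: "('n \<Rightarrow> int) \<Rightarrow> 'n set \<Rightarrow> (int \<Rightarrow> int) \<Rightarrow> int \<Rightarrow> int" where
  "num_on u B H m = (\<Sum>A\<in>Pow B. (-1) ^ card A * H (m - (\<Sum>i\<in>A. u i)))"

lemma num_on_empty [simp]: "num_on u {} H = H"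
  by (rule ext) (simp add: num_on_def)

lemma num_on_add: "num_on u B (\<lambda>j. H j + H' j) m = num_on u B H m + num_on u B H' m"
  by (simp add: num_on_def algebra_simps sum.distrib)

lemma num_on_diff: "num_on u B (\<lambda>j. H j - H' j) m = num_on u B H m - num_on u B H' m"
  by (simp add: num_on_def algebra_simps sum_subtractf)

lemma num_on_zero [simp]: "num_on u B (\<lambda>j. 0) m = 0"
  by (simp add: num_on_def)

lemma num_on_sum: "num_on u B (\<lambda>j. \<Sum>i\<in>I. H i j) m = (\<Sum>i\<in>I. num_on u B (H i) m)"
  by (induction I rule: infinite_finite_induct) (auto simp: num_on_add)

lemma num_on_shift: "num_on u B (\<lambda>j. H (j - a)) m = num_on u B H (m - a)"
  by (simp add: num_on_def algebra_simps)

lemma num_on_insert: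
  assumes "finite B" "x \<notin> B"
  shows "num_on u (insert x B) H = num_on u B (\<lambda>j. H j - H (j - u x))"
proof
  fix m
  let ?t = "\<lambda>A. (-1) ^ card A * H (m - (\<Sum>i\<in>A. u i))"
  have "num_on u (insert x B) H m = (\<Sum>A\<in>Pow B. ?t A) + (\<Sum>A\<in>insert x ` Pow B. ?t A)"
    unfolding num_on_def Pow_insert using assms by (intro sum.union_disjoint) auto
  also have "(\<Sum>A\<in>insert x ` Pow B. ?t A) = (\<Sum>A\<in>Pow B. ?t (insert x A))"
    using assms(2) by (intro sum.reindex_cong[of "insert x"]) (auto simp: inj_on_def)
  also have "\<dots> = (\<Sum>A\<in>Pow B. - ((-1) ^ card A * H (m - u x - (\<Sum>i\<in>A. u i))))"
  proof (intro sum.cong refl)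
    fix A assume "A \<in> Pow B"
    then have "finite A" "x \<notin> A" using assms finite_subset by auto
    then show "?t (insert x A) = - ((-1) ^ card A * H (m - u x - (\<Sum>i\<in>A. u i)))"
      by (simp add: algebra_simps)
  qed
  finally show "num_on u (insert x B) H m = num_on u B (\<lambda>j. H j - H (j - u x)) m"
    by (simp add: num_on_diff num_on_shift[of _ _ H] num_on_def sum_negf)
qed

section \<open>Monomial ideals in a subset of the variables\<close>

definition mons_in :: "'n set \<Rightarrow> ('n \<Rightarrow>\<^sub>0 nat) set" where
  "mons_in B = {\<alpha>. keys \<alpha> \<subseteq> B}"

lemma mons_in_add: "\<alpha> \<in> mons_in B \<Longrightarrow> \<beta> \<in> mons_in B \<Longrightarrow> \<alpha> + \<beta> \<in> mons_in B"
  using Poly_Mapping.keys_add[of \<alpha> \<beta>] by (auto simp: mons_in_def)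

lemma mons_in_addD: "\<alpha> + \<beta> \<in> mons_in B \<Longrightarrow> \<alpha> \<in> mons_in B"
  by (auto simp: mons_in_def subset_iff in_keys_iff lookup_add)

lemma mons_in_single: "x \<in> B \<Longrightarrow> single x c \<in> mons_in B"
  by (auto simp: mons_in_def)

lemma mons_in_mono: "\<alpha> \<in> mons_in A \<Longrightarrow> A \<subseteq> B \<Longrightarrow> \<alpha> \<in> mons_in B"
  by (auto simp: mons_in_def)

lemma mons_in_lookup: "\<alpha> \<in> mons_in A \<Longrightarrow> y \<notin> A \<Longrightarrow> lookup \<alpha> y = 0"
  by (auto simp: mons_in_def subset_iff simp flip: not_in_keys_iff_lookup_eq_zero)

lemma add_single_minus: "c \<le> lookup \<alpha> x \<Longrightarrow> \<alpha> - single x c + single x c = (\<alpha> :: 'n \<Rightarrow>\<^sub>0 nat)"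
  by (intro poly_mapping_eqI) (auto simp: lookup_add lookup_minus lookup_single when_def)

lemma mons_in_split:
  assumes "\<alpha> \<in> mons_in (insert x B)"
  shows "\<alpha> - single x (lookup \<alpha> x) \<in> mons_in B"
  unfolding mons_in_def
proof (intro CollectI subsetI)
  fix y assume "y \<in> keys (\<alpha> - single x (lookup \<alpha> x))"
  then have y: "lookup \<alpha> y - lookup (single x (lookup \<alpha> x)) y \<noteq> 0"
    by (simp add: in_keys_iff lookup_minus)
  then have "y \<noteq> x" by auto
  moreover have "y \<in> keys \<alpha>" using y by (auto simp: in_keys_iff)
  ultimately show "y \<in> B" using assms by (auto simp: mons_in_def)
qed

definition mon_ideal :: "'n set \<Rightarrow> ('n \<Rightarrow>\<^sub>0 nat) set \<Rightarrow> bool" where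
  "mon_ideal B E \<longleftrightarrow> E \<subseteq> mons_in B \<and> (\<forall>\<alpha>\<in>E. \<forall>\<gamma>\<in>mons_in B. \<alpha> + \<gamma> \<in> E)"

text \<open>The coefficient ideal of x^c: for a monomial ideal \<open>E\<close> of K[B][x] the
  slices form an ascending chain of monomial ideals of K[B] that determines
  \<open>E\<close>.\<close>

definition slice :: "'n \<Rightarrow> 'n set \<Rightarrow> ('n \<Rightarrow>\<^sub>0 nat) set \<Rightarrow> nat \<Rightarrow> ('n \<Rightarrow>\<^sub>0 nat) set" where
  "slice x B E c = {\<alpha> \<in> mons_in B. \<alpha> + single x c \<in> E}"

lemma mon_ideal_slice:
  assumes "mon_ideal (insert x B) E" shows "mon_ideal B (slice x B E c)"
  unfolding mon_ideal_def slice_def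
proof (intro conjI ballI)
  fix \<alpha> \<gamma> assume *: "\<alpha> \<in> {\<alpha> \<in> mons_in B. \<alpha> + single x c \<in> E}" "\<gamma> \<in> mons_in B"
  then have "\<alpha> + single x c + \<gamma> \<in> E"
    using assms mons_in_mono[of \<gamma> B "insert x B"] by (auto simp: mon_ideal_def)
  then show "\<alpha> + \<gamma> \<in> {\<alpha> \<in> mons_in B. \<alpha> + single x c \<in> E}"
    using * by (simp add: mons_in_add add_ac)
qed auto

lemma slice_mono:
  assumes "mon_ideal (insert x B) E" "c \<le> d" shows "slice x B E c \<subseteq> slice x B E d"
proof
  fix \<alpha> assume \<alpha>: "\<alpha> \<in> slice x B E c"
  then have "\<alpha> + single x c + single x (d - c) \<in> E"
    using assms mons_in_single[of x "insert x B"] by (auto simp: mon_ideal_def slice_def)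
  moreover have "single x c + single x (d - c) = single x d"
    using assms(2) by (simp flip: single_add)
  ultimately show "\<alpha> \<in> slice x B E d"
    using \<alpha> by (simp add: slice_def add.assoc)
qed

lemma in_slice_split:
  assumes "mon_ideal (insert x B) E" "\<alpha> \<in> E"
  shows "\<alpha> - single x (lookup \<alpha> x) \<in> slice x B E (lookup \<alpha> x)"
  using assms mons_in_split[of \<alpha> x B] by (auto simp: mon_ideal_def slice_def add_single_minus)

text \<open>The slices ascend and their union is finitely generated by induction, so its generators
  all lie in one slice \<open>N\<close>. Generators of the slices up to \<open>N\<close>, each with
  its power of \<open>x\<close>, generate \<open>E\<close>.\<close>

lemma dickson:
  assumes "finite B" "mon_ideal B E"
  shows "\<exists>G. finite G \<and> G \<subseteq> E \<and> (\<forall>\<alpha>\<in>E. \<exists>g\<in>G. \<exists>\<gamma>. \<alpha> = g + \<gamma>)"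
  using assms
proof (induction B arbitrary: E rule: finite_induct)
  case empty
  then have "E \<subseteq> {0}" by (auto simp: mon_ideal_def mons_in_def dest: keys_nonempty)
  then have "finite E" using finite_subset by blast
  then show ?case by (intro exI[of _ E]) (auto intro!: bexI exI[of _ 0])
next
  case (insert x B)
  let ?S = "slice x B E"
  have "mon_ideal B (\<Union>c. ?S c)"
    using mon_ideal_slice[OF insert.prems] by (fastforce simp: mon_ideal_def)
  then obtain G' where G': "finite G'" "G' \<subseteq> (\<Union>c. ?S c)" "\<And>\<alpha>. \<alpha> \<in> (\<Union>c. ?S c) \<Longrightarrow> \<exists>g\<in>G'. \<exists>\<gamma>. \<alpha> = g + \<gamma>"
    using insert.IH by metis
  obtain c where c: "\<And>g. g \<in> G' \<Longrightarrow> g \<in> ?S (c g)"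
    using G'(2) by (metis UN_E subsetD)
  define N where "N = Max (insert 0 (c ` G'))"
  have N: "g \<in> ?S N" if "g \<in> G'" for g
    using c[OF that] that G'(1) slice_mono[OF insert.prems, of "c g" N] by (auto simp: N_def)
  obtain G where G: "\<And>c. finite (G c)" "\<And>c. G c \<subseteq> ?S c" "\<And>c \<alpha>. \<alpha> \<in> ?S c \<Longrightarrow> \<exists>g\<in>G c. \<exists>\<gamma>. \<alpha> = g + \<gamma>"
    using insert.IH[OF mon_ideal_slice[OF insert.prems]] by metis
  show ?case
  proof (intro exI[of _ "\<Union>c\<in>{..N}. (\<lambda>g. g + single x c) ` G c"] conjI ballI)
    show "finite (\<Union>c\<in>{..N}. (\<lambda>g. g + single x c) ` G c)" using G(1) by auto
    show "(\<Union>c\<in>{..N}. (\<lambda>g. g + single x c) ` G c) \<subseteq> E" using G(2) by (fastforce simp: slice_def)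
    fix \<alpha> assume "\<alpha> \<in> E"
    let ?a = "lookup \<alpha> x" and ?\<alpha> = "\<alpha> - single x (lookup \<alpha> x)"
    have S: "?\<alpha> \<in> ?S ?a" using in_slice_split[OF insert.prems \<open>\<alpha> \<in> E\<close>] .
    have eq: "\<alpha> = ?\<alpha> + single x ?a" by (simp add: add_single_minus)
    show "\<exists>g\<in>\<Union>c\<in>{..N}. (\<lambda>g. g + single x c) ` G c. \<exists>\<gamma>. \<alpha> = g + \<gamma>"
    proof (cases "?a \<le> N")
      case True
      obtain g \<gamma> where g: "g \<in> G ?a" "?\<alpha> = g + \<gamma>" using G(3)[OF S] by blast
      have "\<alpha> = g + single x ?a + \<gamma>" using eq g(2) by (simp add: add_ac)
      then show ?thesis using g(1) True by blast
    next
      case False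
      \<comment> \<open>Beyond \<open>N\<close> the slices have stopped growing: a generator of the
        union lies in slice \<open>N\<close>, hence is a multiple of some \<open>b\<close> in
        \<open>G N\<close>.\<close>
      obtain g \<gamma> where g: "g \<in> G'" "?\<alpha> = g + \<gamma>" using G'(3)[of ?\<alpha>] S by blast
      obtain b \<delta> where b: "b \<in> G N" "g = b + \<delta>" using G(3)[OF N[OF g(1)]] by blast
      have "single x ?a = single x N + single x (?a - N)"
        using False by (simp flip: single_add)
      then have "\<alpha> = b + single x N + (\<delta> + \<gamma> + single x (?a - N))"
        using eq g(2) b(2) by (simp add: add_ac)
      then show ?thesis using b(1) by blast
    qed
  qed
qed

lemma finite_wdeg_eq:
  fixes u :: "'n::finite \<Rightarrow> int"
  assumes "\<And>i. u i > 0"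
  shows "finite {\<alpha>. wdeg u \<alpha> = j}"
proof -
  have "lookup \<alpha> i \<le> nat j" if "wdeg u \<alpha> = j" for \<alpha> i
  proof -
    have "u i * int (lookup \<alpha> i) \<le> wdeg u \<alpha>"
      unfolding wdeg_def using assms by (intro member_le_sum) (auto simp: less_imp_le)
    moreover have "1 * int (lookup \<alpha> i) \<le> u i * int (lookup \<alpha> i)"
      using assms[of i] by (intro mult_right_mono) auto
    ultimately show ?thesis using that by linarith
  qed
  then have "lookup ` {\<alpha>. wdeg u \<alpha> = j} \<subseteq> (UNIV \<rightarrow>\<^sub>E {..nat j})"
    by auto
  moreover have "finite ((UNIV :: 'n set) \<rightarrow>\<^sub>E {..nat j})"
    by (intro finite_PiE) auto
  ultimately have "finite (lookup ` {\<alpha>. wdeg u \<alpha> = j})"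
    using finite_subset by blast
  then show ?thesis
    by (rule finite_imageD) (rule inj_onI, simp only: poly_mapping_eq_iff)
qed

definition mon_count :: "('n::finite \<Rightarrow> int) \<Rightarrow> ('n \<Rightarrow>\<^sub>0 nat) set \<Rightarrow> int \<Rightarrow> int" where
  "mon_count u E j = int (card {\<alpha> \<in> E. wdeg u \<alpha> = j})"

text \<open>The exponent of \<open>i\<close> in the greatest common divisor of the monomials of
  \<open>E\<close>; it is unspecified for empty \<open>E\<close>, which is treated apart
  below.\<close>

definition min_exp :: "('n \<Rightarrow>\<^sub>0 nat) set \<Rightarrow> 'n \<Rightarrow> nat" where
  "min_exp E i = (LEAST n. \<exists>\<alpha>\<in>E. lookup \<alpha> i = n)"

lemma min_exp_le: "\<alpha> \<in> E \<Longrightarrow> min_exp E i \<le> lookup \<alpha> i"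
  unfolding min_exp_def by (rule Least_le) blast

lemma min_exp_attained:
  assumes "E \<noteq> {}" obtains \<alpha> where "\<alpha> \<in> E" "lookup \<alpha> i = min_exp E i"
proof -
  have "\<exists>n. \<exists>\<alpha>\<in>E. lookup \<alpha> i = n" using assms by blast
  then have "\<exists>\<alpha>\<in>E. lookup \<alpha> i = min_exp E i" unfolding min_exp_def by (rule LeastI_ex)
  then show ?thesis using that by blast
qed

lemma min_exp_mono: "E \<noteq> {} \<Longrightarrow> E \<subseteq> E' \<Longrightarrow> min_exp E' i \<le> min_exp E i"
  by (metis min_exp_attained min_exp_le subsetD)

text \<open>The empty set stands for the slice before the 0th, so that truncated subtraction in
  \<open>c - 1\<close> does no harm.\<close>

lemma sum_telescope_slices:
  fixes f :: "'s set \<Rightarrow> int"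
  assumes "f {} = 0"
  shows "(\<Sum>c\<le>N. f (S c) - f (if c = 0 then {} else S (c - 1))) = f (S (N::nat))"
  by (induction N) (auto simp: assms)

text \<open>Multiplication by \<open>1 - t^(u x)\<close> leaves, for each \<open>c\<close>, the monomials of the \<open>c\<close>-th slice in direction
  \<open>x\<close> that are not in the previous slice; by Dickson's lemma only finitely many \<open>c\<close> contribute.\<close>

theorem mon_ideal_moments:
  fixes u :: "'n::finite \<Rightarrow> int"
  assumes u: "\<And>i. u i > 0" and "finite B" "mon_ideal B E"
  shows "has_moments (num_on u B (mon_count u E)) (if E = {} then 0 else 1)
    (if E = {} then 0 else \<Sum>i\<in>B. u i * int (min_exp E i))"
  using assms(2,3)
proof (induction B arbitrary: E rule: finite_induct)
  case empty
  then have "E = {} \<or> E = {0}" by (auto simp: mon_ideal_def mons_in_def dest: keys_nonempty)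
  moreover have "{\<alpha>. \<alpha> = 0 \<and> wdeg u \<alpha> = j} = (if j = 0 then {0} else {})" for j
    by auto
  then have "mon_count u {0} = (\<lambda>j. if j = 0 then 1 else 0)"
    by (auto simp: mon_count_def)
  moreover have "mon_count u {} = (\<lambda>j. 0)"
    by (auto simp: mon_count_def)
  moreover have "{m::int. m = 0} = {0}" by auto
  ultimately show ?case by (auto simp: has_moments_def)
next
  case (insert x B)
  show ?case
  proof (cases "E = {}")
    case True
    have "num_on u (insert x B) (mon_count u {}) = (\<lambda>_. 0)"
      by (rule ext) (simp add: num_on_def mon_count_def)
    then show ?thesis using True by (simp add: has_moments_zero)
  next
    case False
    let ?S = "slice x B E"
    let ?S' = "\<lambda>c. if c = 0 then {} else ?S (c - 1)"
    note ideal = insert.prems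
    have S'_sub: "?S' c \<subseteq> ?S c" for c using slice_mono[OF ideal, of "c - 1" c] by auto
    obtain G where G: "finite G" "G \<subseteq> E" "\<And>\<alpha>. \<alpha> \<in> E \<Longrightarrow> \<exists>g\<in>G. \<exists>\<gamma>. \<alpha> = g + \<gamma>"
      using dickson[OF _ ideal] insert.hyps by blast
    \<comment> \<open>The largest exponent of \<open>x\<close> among the generators; the slices are
      constant from \<open>N\<close> on.\<close>
    define N where "N = Max (insert 0 ((\<lambda>g. lookup g x) ` G))"
    have N: "lookup g x \<le> N" if "g \<in> G" for g using G(1) that by (auto simp: N_def)
    have closed: "\<alpha> + \<gamma> \<in> E" if "\<alpha> \<in> E" "\<gamma> \<in> mons_in (insert x B)" for \<alpha> \<gamma>
      using ideal that by (auto simp: mon_ideal_def)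
    have EB: "\<alpha> \<in> mons_in (insert x B)" if "\<alpha> \<in> E" for \<alpha> using ideal that by (auto simp: mon_ideal_def)
    have SN: "\<alpha> - single x (lookup \<alpha> x) \<in> ?S N" if \<alpha>: "\<alpha> \<in> E" for \<alpha>
    proof -
      obtain g \<gamma> where g: "g \<in> G" "\<alpha> = g + \<gamma>" using G(3)[OF \<alpha>] by blast
      have *: "\<alpha> - single x (lookup \<alpha> x) + single x N = g + (\<gamma> - single x (lookup \<gamma> x) + single x (N - lookup g x))"
        using N[OF g(1)] by (intro poly_mapping_eqI) (auto simp: g(2) lookup_add lookup_minus lookup_single when_def)
      have "\<gamma> \<in> mons_in (insert x B)"
        using EB[OF \<alpha>] g(2) mons_in_addD[of \<gamma> g] by (simp add: add.commute)
      then have "\<gamma> - single x (lookup \<gamma> x) + single x (N - lookup g x) \<in> mons_in (insert x B)"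
        by (intro mons_in_add mons_in_single mons_in_mono[OF mons_in_split]) auto
      then have "\<alpha> - single x (lookup \<alpha> x) + single x N \<in> E"
        unfolding * using closed G(2) g(1) by blast
      then show ?thesis using mons_in_split[OF EB[OF \<alpha>]] by (simp add: slice_def)
    qed
    \<comment> \<open>Multiplication by \<open>x\<close> maps \<open>E\<close> injectively into
      itself and raises degrees by \<open>u x\<close>, so the difference counts \<open>F\<close>,
      the monomials of \<open>E\<close> that are not \<open>x\<close> times one of \<open>E\<close>.
      Sorted by their exponent of \<open>x\<close>, these are the sets \<open>?L c\<close>.\<close>
    have diff: "mon_count u E j - mon_count u E (j - u x) =
      (\<Sum>c\<le>N. mon_count u (?S c) (j - u x * int c) - mon_count u (?S' c) (j - u x * int c))" for j
    proof -
      define F where "F = {\<alpha>\<in>E. wdeg u \<alpha> = j \<and> \<not> (\<exists>\<gamma>\<in>E. \<alpha> = \<gamma> + single x 1)}"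
      define I where "I = (\<lambda>\<gamma>. \<gamma> + single x 1) ` {\<gamma>\<in>E. wdeg u \<gamma> = j - u x}"
      have fin: "finite {\<alpha>\<in>E'. wdeg u \<alpha> = l}" for E' l
        by (rule finite_subset[OF _ finite_wdeg_eq[of u l, OF u]]) auto
      have "{\<alpha>\<in>E. wdeg u \<alpha> = j} = F \<union> I"
        unfolding F_def I_def using closed mons_in_single[of x "insert x B"] by (auto simp: wdeg_add)
      moreover have "F \<inter> I = {}" by (auto simp: F_def I_def)
      moreover have "finite F" "finite I" using fin[of E j] fin[of E "j - u x"]
        by (auto simp: F_def I_def intro: finite_subset[rotated])
      moreover have "card I = card {\<gamma>\<in>E. wdeg u \<gamma> = j - u x}"
        unfolding I_def by (intro card_image) (auto simp: inj_on_def)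
      ultimately have 1: "mon_count u E j - mon_count u E (j - u x) = int (card F)"
        by (simp add: mon_count_def card_Un_disjoint)
      let ?A = "\<lambda>c. {\<alpha>\<in>?S c. wdeg u \<alpha> = j - u x * int c}" and ?A' = "\<lambda>c. {\<alpha>\<in>?S' c. wdeg u \<alpha> = j - u x * int c}"
      let ?L = "\<lambda>c. (\<lambda>\<alpha>. \<alpha> + single x c) ` (?A c - ?A' c)"
      have lookup_L: "lookup \<alpha> x = c" if "\<alpha> \<in> ?L c" for \<alpha> c
        using that insert.hyps(2) by (auto simp: slice_def lookup_add mons_in_lookup)
      have "F = (\<Union>c\<in>{..N}. ?L c)"
      proof (intro equalityI subsetI)
        fix \<alpha> assume "\<alpha> \<in> F"
        then have \<alpha>: "\<alpha> \<in> E" "wdeg u \<alpha> = j" "\<And>\<gamma>. \<gamma> \<in> E \<Longrightarrow> \<alpha> \<noteq> \<gamma> + single x 1"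
          by (auto simp: F_def)
        let ?c = "lookup \<alpha> x"
        have eq: "\<alpha> = \<alpha> - single x ?c + single x ?c" by (simp add: add_single_minus)
        obtain g \<gamma> where g: "g \<in> G" "\<alpha> = g + \<gamma>" using G(3)[OF \<alpha>(1)] by blast
        \<comment> \<open>Otherwise dividing \<alpha> by \<open>x\<close> would leave a multiple of
          \<open>g\<close>, still in \<open>E\<close>; so the exponent of \<open>x\<close> in
          \<alpha> is that of a generator.\<close>
        have "lookup \<gamma> x = 0"
        proof (rule ccontr)
          assume "lookup \<gamma> x \<noteq> 0"
          then have \<gamma>: "\<gamma> - single x 1 + single x 1 = \<gamma>" by (intro add_single_minus) simp
          then have "\<alpha> = g + (\<gamma> - single x 1) + single x 1" using g(2) by (simp add: add.assoc)
          moreover have "\<gamma> - single x 1 \<in> mons_in (insert x B)"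
            using EB[OF \<alpha>(1)] g(2) \<gamma> mons_in_addD by (metis add.commute)
          ultimately show False using \<alpha>(3) closed g(1) G(2) by blast
        qed
        then have "?c \<le> N" using N[OF g(1)] by (simp add: g(2) lookup_add)
        moreover have "\<alpha> - single x ?c \<in> ?A ?c"
          using in_slice_split[OF ideal \<alpha>(1)] \<alpha>(2) eq wdeg_add[of u "\<alpha> - single x ?c" "single x ?c"] by simp
        moreover have "\<alpha> - single x ?c \<notin> ?S' ?c"
        proof
          assume *: "\<alpha> - single x ?c \<in> ?S' ?c"
          then have c: "?c \<noteq> 0" by (auto split: if_splits)
          then have "\<alpha> - single x ?c + single x (?c - 1) \<in> E" using * by (simp add: slice_def)
          moreover have "single x ?c = single x (?c - 1) + single x 1"
            using c by (simp flip: single_add)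
          then have "\<alpha> = \<alpha> - single x ?c + single x (?c - 1) + single x 1"
            using eq by (simp add: add.assoc)
          ultimately show False using \<alpha>(3) by blast
        qed
        ultimately show "\<alpha> \<in> (\<Union>c\<in>{..N}. ?L c)" using eq by blast
      next
        fix \<alpha> assume "\<alpha> \<in> (\<Union>c\<in>{..N}. ?L c)"
        then obtain c \<beta> where c: "\<beta> \<in> ?S c" "wdeg u \<beta> = j - u x * int c" "\<beta> \<notin> ?S' c" "\<alpha> = \<beta> + single x c"
          by blast
        have "\<alpha> \<noteq> \<gamma> + single x 1" if "\<gamma> \<in> E" for \<gamma>
        proof
          assume eq: "\<alpha> = \<gamma> + single x 1"
          have "lookup \<beta> x = 0" using c(1) insert.hyps(2) by (auto simp: slice_def mons_in_lookup)
          then have "lookup \<gamma> x + 1 = c" using eq c(4) by (metis add_0 lookup_add lookup_single_eq)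
          moreover from this have "single x c = single x (c - 1) + single x 1" by (simp flip: single_add)
          then have "\<beta> + single x (c - 1) = \<gamma>" using eq c(4) by (simp flip: add.assoc)
          ultimately show False using that c(1,3) by (auto simp: slice_def)
        qed
        then show "\<alpha> \<in> F" using c by (auto simp: F_def slice_def wdeg_add)
      qed
      then have "card F = card (\<Union>c\<in>{..N}. ?L c)" by (rule arg_cong)
      also have "\<dots> = (\<Sum>c\<le>N. card (?L c))"
      proof (rule card_UN_disjoint)
        show "\<forall>c\<in>{..N}. finite (?L c)"
          using fin by (intro ballI finite_imageI finite_Diff)
        have "?L c \<inter> ?L c' = {}" if "c \<noteq> c'" for c c'
        proof (rule equals0I)
          fix \<alpha> assume \<alpha>: "\<alpha> \<in> ?L c \<inter> ?L c'"
          show False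
            using lookup_L[OF IntD1[OF \<alpha>]] lookup_L[OF IntD2[OF \<alpha>]] that by (simp only:)
        qed
        then show "\<forall>c\<in>{..N}. \<forall>c'\<in>{..N}. c \<noteq> c' \<longrightarrow> ?L c \<inter> ?L c' = {}" by blast
      qed simp
      also have "\<dots> = (\<Sum>c\<le>N. card (?A c - ?A' c))"
        by (intro sum.cong refl card_image) (auto simp: inj_on_def)
      finally have "int (card F) = (\<Sum>c\<le>N. int (card (?A c - ?A' c)))" by simp
      also have "\<dots> = (\<Sum>c\<le>N. mon_count u (?S c) (j - u x * int c) - mon_count u (?S' c) (j - u x * int c))"
      proof (intro sum.cong refl)
        fix c
        have "?A' c \<subseteq> ?A c" using S'_sub[of c] by blast
        then show "int (card (?A c - ?A' c)) = mon_count u (?S c) (j - u x * int c) - mon_count u (?S' c) (j - u x * int c)"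
          unfolding mon_count_def by (subst card_Diff_subset) (auto simp: fin intro!: of_nat_diff card_mono simp del: if_split)
      qed
      finally show ?thesis using 1 by simp
    qed
    let ?r = "\<lambda>E. if E = {} then 0 else 1 :: int"
    let ?w = "\<lambda>E. if E = {} then 0 else \<Sum>i\<in>B. u i * int (min_exp E i)"
    let ?n = "\<lambda>E. num_on u B (mon_count u E)"
    have IH: "has_moments (\<lambda>m. ?n E' (m - a)) (?r E') (?w E' + a * ?r E')" if "mon_ideal B E'" for E' a
      using has_moments_shift[OF insert.IH[OF that]] .
    have empty_ideal: "mon_ideal B {}" by (simp add: mon_ideal_def)
    have eq: "num_on u (insert x B) (mon_count u E) =
      (\<lambda>m. \<Sum>c\<le>N. ?n (?S c) (m - u x * int c) - ?n (?S' c) (m - u x * int c))"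
      unfolding num_on_insert[OF insert.hyps] diff num_on_sum num_on_diff num_on_shift ..
    have main: "has_moments (num_on u (insert x B) (mon_count u E)) (\<Sum>c\<le>N. ?r (?S c) - ?r (?S' c))
      (\<Sum>c\<le>N. (?w (?S c) + u x * int c * ?r (?S c)) - (?w (?S' c) + u x * int c * ?r (?S' c)))"
      unfolding eq
    proof (intro has_moments_sum has_moments_diff IH mon_ideal_slice[OF ideal])
      show "mon_ideal B (?S' c)" for c using empty_ideal mon_ideal_slice[OF ideal] by simp
    qed auto
    obtain \<alpha>0 where \<alpha>0: "\<alpha>0 \<in> E" "lookup \<alpha>0 x = min_exp E x" using min_exp_attained[OF False] .
    have S_ne: "?S c \<noteq> {} \<longleftrightarrow> min_exp E x \<le> c" for c
    proof
      assume "?S c \<noteq> {}"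
      then obtain \<beta> where "\<beta> \<in> mons_in B" "\<beta> + single x c \<in> E" by (auto simp: slice_def)
      then show "min_exp E x \<le> c"
        using min_exp_le[of "\<beta> + single x c" E x] insert.hyps(2) by (simp add: lookup_add mons_in_lookup)
    next
      assume "min_exp E x \<le> c"
      then show "?S c \<noteq> {}"
        using in_slice_split[OF ideal \<alpha>0(1)] slice_mono[OF ideal, of "min_exp E x" c] \<alpha>0(2) by auto
    qed
    have SN_ne: "?S N \<noteq> {}" using SN[OF \<alpha>0(1)] by blast
    have r: "(\<Sum>c\<le>N. ?r (?S c) - ?r (?S' c)) = 1"
      using sum_telescope_slices[of ?r ?S N] SN_ne by simp
    have S_e: "?S c = {} \<longleftrightarrow> c < min_exp E x" for c using S_ne[of c] by linarith
    \<comment> \<open>The rank jumps from 0 to 1 exactly once, at the first nonempty slice, whose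
      index is \<open>min_exp E x\<close>; weighted by the shift \<open>u x * int c\<close>, this
      jump yields the contribution of \<open>x\<close>.\<close>
    have "?r (?S c) - ?r (?S' c) = (if c = min_exp E x then 1 else 0)" for c
      by (cases c) (simp_all add: S_e)
    then have "(\<Sum>c\<le>N. u x * int c * (?r (?S c) - ?r (?S' c))) = (\<Sum>c\<le>N. if c = min_exp E x then u x * int c else 0)"
      by (intro sum.cong) auto
    also have "\<dots> = u x * int (min_exp E x)" using S_ne[of N] SN_ne by simp
    finally have ux: "(\<Sum>c\<le>N. u x * int c * (?r (?S c) - ?r (?S' c))) = u x * int (min_exp E x)" .
    \<comment> \<open>Powers of \<open>x\<close> do not affect the other exponents, so the top slice
      has the same minimal exponents in \<open>B\<close> as \<open>E\<close>.\<close>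
    have "min_exp (?S N) i = min_exp E i" if "i \<in> B" for i
    proof -
      have ix: "i \<noteq> x" using that insert.hyps(2) by auto
      have "(\<exists>\<alpha>\<in>?S N. lookup \<alpha> i = n) \<longleftrightarrow> (\<exists>\<alpha>\<in>E. lookup \<alpha> i = n)" for n
      proof
        assume "\<exists>\<alpha>\<in>?S N. lookup \<alpha> i = n"
        then obtain \<alpha> where "\<alpha> + single x N \<in> E" "lookup \<alpha> i = n" by (auto simp: slice_def)
        then show "\<exists>\<alpha>\<in>E. lookup \<alpha> i = n"
          using ix by (intro bexI[of _ "\<alpha> + single x N"]) (auto simp: lookup_add lookup_single when_def)
      next
        assume "\<exists>\<alpha>\<in>E. lookup \<alpha> i = n"
        then obtain \<alpha> where "\<alpha> \<in> E" "lookup \<alpha> i = n" by blast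
        then show "\<exists>\<alpha>\<in>?S N. lookup \<alpha> i = n"
          using ix SN by (intro bexI[of _ "\<alpha> - single x (lookup \<alpha> x)"]) (auto simp: lookup_minus lookup_single when_def)
      qed
      then show ?thesis by (simp add: min_exp_def)
    qed
    then have w: "(\<Sum>c\<le>N. ?w (?S c) - ?w (?S' c)) = (\<Sum>i\<in>B. u i * int (min_exp E i))"
      using sum_telescope_slices[of ?w ?S N] SN_ne by simp
    have "(\<Sum>c\<le>N. (?w (?S c) + u x * int c * ?r (?S c)) - (?w (?S' c) + u x * int c * ?r (?S' c))) =
      (\<Sum>c\<le>N. ?w (?S c) - ?w (?S' c)) + (\<Sum>c\<le>N. u x * int c * (?r (?S c) - ?r (?S' c)))"
      unfolding sum.distrib[symmetric] by (intro sum.cong refl) (simp only: algebra_simps)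
    then show ?thesis
      using main False insert.hyps unfolding r w ux by (simp add: add.commute)
  qed
qed

section \<open>Hilbert functions of graded ideals\<close>

context vector_space_pair
begin

text \<open>Rank-nullity for the map from \<open>V\<close> to the quotient by \<open>N\<close>,
  without the quotient. A basis \<open>B'\<close> of the preimage of \<open>N\<close> is extended to
  a basis \<open>B\<close> of \<open>V\<close>; the images of \<open>B - B'\<close> together with a
  basis \<open>K\<close> of \<open>N\<close> form a basis of f(V) + N.\<close>

lemma dim_image_plus:
  assumes lin: "Vector_Spaces.linear s1 s2 f" and V: "vs1.subspace V" and N: "vs2.subspace N"
    and finV: "finite X" "V \<subseteq> vs1.span X" and finN: "finite Y" "N \<subseteq> vs2.span Y"
  shows "vs1.dim V + vs2.dim N = vs2.dim {f v + n | v n. v \<in> V \<and> n \<in> N} + vs1.dim {v \<in> V. f v \<in> N}"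
proof -
  let ?V' = "{v \<in> V. f v \<in> N}" and ?P = "{f v + n | v n. v \<in> V \<and> n \<in> N}"
  interpret f: Vector_Spaces.linear s1 s2 f by (rule lin)
  have V': "vs1.subspace ?V'"
    using V N by (auto simp: vs1.subspace_def vs2.subspace_def f.add f.scale f.zero)
  obtain B' where B': "B' \<subseteq> ?V'" "vs1.independent B'" "?V' \<subseteq> vs1.span B'"
    using vs1.maximal_independent_subset by blast
  obtain B where B: "B' \<subseteq> B" "B \<subseteq> V" "vs1.independent B" "V \<subseteq> vs1.span B"
    using vs1.maximal_independent_subset_extend[of B' V] B' by blast
  obtain K where K: "K \<subseteq> N" "vs2.independent K" "N \<subseteq> vs2.span K"
    using vs2.maximal_independent_subset by blast
  have spanB': "vs1.span B' = ?V'"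
    using B' V' by (simp add: subset_antisym vs1.span_minimal)
  have spanK: "vs2.span K = N"
    using K N by (simp add: subset_antisym vs2.span_minimal)
  have finB: "finite B"
    using vs1.independent_span_bound[OF finV(1) B(3)] B(2) finV(2) by auto
  have finK: "finite K"
    using vs2.independent_span_bound[OF finN(1) K(2)] K(1) finN(2) by auto
  \<comment> \<open>Independence and the count are proved together; the count says that
    \<open>f\<close> is injective on \<open>C\<close> with images outside \<open>K\<close>.\<close>
  have key: "vs2.independent (f ` C \<union> K) \<and> card (f ` C \<union> K) = card C + card K"
    if "finite C" "C \<subseteq> B - B'" for C
    using that
  proof (induction C rule: finite_induct)
    case empty
    then show ?case using K by simp
  next
    case (insert c C)
    have notin: "f c \<notin> vs2.span (f ` C \<union> K)"
    proof
      assume "f c \<in> vs2.span (f ` C \<union> K)"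
      then obtain w n where w: "w \<in> vs1.span C" "n \<in> N" "f c = f w + n"
        unfolding vs2.span_Un f.span_image spanK by auto
      have "w \<in> V"
        using w(1) insert.prems B(2) V vs1.span_minimal[of C V] by blast
      \<comment> \<open>As \<open>f\<close> sends \<open>c - w\<close> into \<open>N\<close>, this
        difference is a combination of \<open>B'\<close>, and \<open>c\<close> would depend on the
        other elements of \<open>B\<close>.\<close>
      then have "c - w \<in> ?V'"
        using insert.prems B(2) w V by (auto simp: f.diff vs1.subspace_diff)
      then have "c - w \<in> vs1.span (B - {c})"
        unfolding spanB'[symmetric] using insert.prems B(1) vs1.span_mono[of B' "B - {c}"] by blast
      moreover have "w \<in> vs1.span (B - {c})"
        using w(1) insert vs1.span_mono[of C "B - {c}"] by blast
      ultimately have "c - w + w \<in> vs1.span (B - {c})" by (rule vs1.span_add)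
      then show False
        using B(3) insert.prems by (simp add: vs1.dependent_def)
    qed
    then have "f c \<notin> f ` C \<union> K" by (rule contrapos_nn) (rule vs2.span_base)
    moreover have "vs2.independent (f ` C \<union> K)" "card (f ` C \<union> K) = card C + card K"
      using insert.IH insert.prems by auto
    moreover have "finite (f ` C \<union> K)" using finK insert.hyps(1) by simp
    ultimately show ?case
      using insert.hyps notin vs2.independent_insert[of "f c" "f ` C \<union> K"] by simp
  qed
  let ?C = "B - B'"
  have ind: "vs2.independent (f ` ?C \<union> K)" "card (f ` ?C \<union> K) = card ?C + card K"
    using key[of ?C] finB by auto
  have "vs2.dim ?P = card (f ` ?C \<union> K)"
  proof (rule vs2.basis_card_eq_dim[OF _ _ ind(1), symmetric])
    have "f c + 0 \<in> ?P" if "c \<in> V" for c using that N vs2.subspace_0 by blast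
    moreover have "f 0 + n \<in> ?P" if "n \<in> N" for n using that V vs1.subspace_0 by blast
    ultimately show "f ` ?C \<union> K \<subseteq> ?P" using B(2) K(1) by (auto simp: f.zero)
    show "?P \<subseteq> vs2.span (f ` ?C \<union> K)"
    proof safe
      fix v n assume "v \<in> V" "n \<in> N"
      moreover have "B = B' \<union> ?C" using B(1) by auto
      then have "vs1.span B = {x + y |x y. x \<in> vs1.span B' \<and> y \<in> vs1.span ?C}"
        by (metis vs1.span_Un)
      ultimately obtain b c where "v = b + c" "b \<in> ?V'" "c \<in> vs1.span ?C"
        using B(4) unfolding spanB' by blast
      then have "f v + n = f c + (f b + n)" "f c \<in> vs2.span (f ` ?C)" "f b + n \<in> vs2.span K"
        using \<open>n \<in> N\<close> N unfolding spanK f.span_image by (auto simp: f.add vs2.subspace_add)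
      then show "f v + n \<in> vs2.span (f ` ?C \<union> K)"
        unfolding vs2.span_Un by blast
    qed
  qed
  moreover have "vs1.dim V = card B" "vs1.dim ?V' = card B'" "vs2.dim N = card K"
    using vs1.basis_card_eq_dim[OF B(2,4,3)] vs1.basis_card_eq_dim[OF B'(1,3,2)] vs2.basis_card_eq_dim[OF K(1,3,2)]
    by simp_all
  moreover have "card B = card ?C + card B'"
    using B(1) finB by (simp add: card_Diff_subset card_mono finite_subset)
  ultimately show ?thesis using ind(2) by simp
qed

end

section \<open>Dimension of a space of polynomials by leading monomials\<close>

definition mscale :: "'a::comm_ring_1 \<Rightarrow> ('n, 'a) mpoly \<Rightarrow> ('n, 'a) mpoly" where
  "mscale c p = single 0 c * p"

interpretation mpoly: vector_space "mscale :: 'a::field \<Rightarrow> ('n::finite, 'a) mpoly \<Rightarrow> ('n, 'a) mpoly"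
  by unfold_locales (simp_all add: mscale_def algebra_simps single_add mult_single flip: mult.assoc)

interpretation scalar: vector_space "(*) :: 'a::field \<Rightarrow> 'a \<Rightarrow> 'a"
  by unfold_locales (simp_all add: algebra_simps)

interpretation mpoly_scalar: vector_space_pair
  "mscale :: 'a::field \<Rightarrow> ('n::finite, 'a) mpoly \<Rightarrow> ('n, 'a) mpoly" "(*) :: 'a \<Rightarrow> 'a \<Rightarrow> 'a" ..

interpretation mpoly_mpoly: vector_space_pair
  "mscale :: 'a::field \<Rightarrow> ('n::finite, 'a) mpoly \<Rightarrow> ('n, 'a) mpoly"
  "mscale :: 'a \<Rightarrow> ('n, 'a) mpoly \<Rightarrow> ('n, 'a) mpoly" ..

lemma lookup_mscale [simp]: "lookup (mscale c p) m = c * lookup p m"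
  for p :: "('n::finite, 'a::comm_ring_1) mpoly"
  by (simp add: mscale_def)

lemma scalar_dim: "scalar.dim (UNIV :: 'a::field set) = 1" "scalar.dim {0 :: 'a} = 0"
proof -
  have "x \<in> scalar.span {1}" for x :: 'a
    using scalar.span_scale[OF scalar.span_base[of 1 "{1}"], of x] by simp
  then have "card {1 :: 'a} = scalar.dim (UNIV :: 'a set)"
    by (intro scalar.basis_card_eq_dim) auto
  then show "scalar.dim (UNIV :: 'a set) = 1" by simp
  have "card ({} :: 'a set) = scalar.dim {0 :: 'a}"
    by (intro scalar.basis_card_eq_dim scalar.independent_empty) auto
  then show "scalar.dim {0 :: 'a} = 0" by simp
qed

lemma mpoly_in_span_monomials:
  fixes p :: "('n::finite, 'a::field) mpoly"
  assumes "keys p \<subseteq> X" shows "p \<in> mpoly.span ((\<lambda>m. single m 1) ` X)"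
proof -
  have "p = (\<Sum>m\<in>keys p. mscale (lookup p m) (single m 1))"
    using poly_mapping_sum_singles[of p] by (simp add: mscale_def mult_single)
  also have "\<dots> \<in> mpoly.span ((\<lambda>m. single m 1) ` X)"
    using assms by (intro mpoly.span_sum mpoly.span_scale mpoly.span_base) auto
  finally show ?thesis .
qed

text \<open>The monomials of \<open>X\<close> are added in increasing order of
  \<open>lex_key\<close>. The coefficient at the newest and largest monomial \<open>x\<close> is a
  linear functional whose kernel is the previous space; its image is the whole field or 0 according
  to whether \<open>x\<close> is a leading monomial of some element.\<close>

lemma dim_eq_card_lead_bounded:
  fixes V :: "('n::finite, 'a::field) mpoly set"
  assumes V: "mpoly.subspace V" and "finite X"
  shows "mpoly.dim {p \<in> V. keys p \<subseteq> X} = card (lead ` {p \<in> V. p \<noteq> 0 \<and> keys p \<subseteq> X})"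
  using assms(2)
proof (induction X rule: finite_ranking_induct[where f = lex_key])
  case empty
  have "{p \<in> V. keys p \<subseteq> {}} = {0}"
    using mpoly.subspace_0[OF V] by (auto dest: keys_nonempty)
  moreover have "card ({} :: ('n, 'a) mpoly set) = mpoly.dim {0 :: ('n, 'a) mpoly}"
    by (intro mpoly.basis_card_eq_dim mpoly.independent_empty) auto
  moreover have "{p \<in> V. p \<noteq> 0 \<and> keys p \<subseteq> {}} = {}" by (auto dest: keys_nonempty)
  ultimately show ?case by simp
next
  case (insert x X)
  show ?case
  proof (cases "x \<in> X")
    case False
    let ?V = "{p \<in> V. keys p \<subseteq> insert x X}" and ?U = "{p \<in> V. keys p \<subseteq> X}"
    have sub: "mpoly.subspace ?V"
      unfolding mpoly.subspace_def
    proof (intro conjI ballI allI)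
      show "0 \<in> ?V" using V by (simp add: mpoly.subspace_0)
      show "p + q \<in> ?V" if "p \<in> ?V" "q \<in> ?V" for p q
        using that V Poly_Mapping.keys_add[of p q] by (auto simp: mpoly.subspace_add)
      show "mscale c p \<in> ?V" if "p \<in> ?V" for c p
        using that V by (auto simp: mpoly.subspace_scale in_keys_iff)
    qed
    have lin: "Vector_Spaces.linear mscale (*) (\<lambda>p :: ('n, 'a) mpoly. lookup p x)"
      unfolding Vector_Spaces.linear_iff
      by (simp add: lookup_add mpoly.vector_space_axioms scalar.vector_space_axioms)
    have span: "?V \<subseteq> mpoly.span ((\<lambda>m. single m 1) ` insert x X)"
      using mpoly_in_span_monomials by blast
    have "mpoly.dim ?V + scalar.dim {0 :: 'a} =
        scalar.dim {lookup v x + n |v n. v \<in> ?V \<and> n \<in> {0}} + mpoly.dim {v \<in> ?V. lookup v x \<in> {0}}"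
      using mpoly_scalar.dim_image_plus[OF lin sub scalar.subspace_single_0 _ span finite.emptyI] insert.hyps(1)
      by simp
    moreover have "{v \<in> ?V. lookup v x \<in> {0}} = ?U"
      using False by (auto simp: in_keys_iff subset_iff)
    moreover have "{lookup v x + n |v n. v \<in> ?V \<and> n \<in> {0}} = (\<lambda>v. lookup v x) ` ?V" by auto
    ultimately have dim: "mpoly.dim ?V = scalar.dim ((\<lambda>v. lookup v x) ` ?V) + mpoly.dim ?U"
      by (simp add: scalar_dim)
    have lead_x: "lead p = x" if "p \<in> ?V" "lookup p x \<noteq> 0" for p
      using that insert.hyps by (intro lead_eqI) (auto simp: in_keys_iff)
    have lead_U: "p \<in> ?U" if "p \<in> ?V" "lookup p x = 0" for p
      using that by (auto simp: in_keys_iff subset_iff)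
    show ?thesis
    proof (cases "\<exists>p\<in>?V. lookup p x \<noteq> 0")
      case True
      then obtain p where p: "p \<in> ?V" "lookup p x \<noteq> 0" by blast
      have "c \<in> (\<lambda>v. lookup v x) ` ?V" for c
        using p mpoly.subspace_scale[OF sub p(1), of "c / lookup p x"]
        by (intro image_eqI[of _ _ "mscale (c / lookup p x) p"]) auto
      then have "(\<lambda>v. lookup v x) ` ?V = UNIV" by blast
      moreover have "lead ` {p \<in> V. p \<noteq> 0 \<and> keys p \<subseteq> insert x X} = insert x (lead ` {p \<in> V. p \<noteq> 0 \<and> keys p \<subseteq> X})"
      proof (intro equalityI subsetI)
        fix y assume "y \<in> lead ` {p \<in> V. p \<noteq> 0 \<and> keys p \<subseteq> insert x X}"
        then obtain q where "q \<in> ?V" "q \<noteq> 0" "y = lead q" by blast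
        then show "y \<in> insert x (lead ` {p \<in> V. p \<noteq> 0 \<and> keys p \<subseteq> X})"
          using lead_x[of q] lead_U[of q] by (cases "lookup q x = 0") auto
      next
        fix y assume "y \<in> insert x (lead ` {p \<in> V. p \<noteq> 0 \<and> keys p \<subseteq> X})"
        moreover have "p \<noteq> 0" using p(2) by auto
        then have "x \<in> lead ` {p \<in> V. p \<noteq> 0 \<and> keys p \<subseteq> insert x X}"
          using p(1) lead_x[OF p] by force
        ultimately show "y \<in> lead ` {p \<in> V. p \<noteq> 0 \<and> keys p \<subseteq> insert x X}" by auto
      qed
      moreover have "x \<notin> lead ` {p \<in> V. p \<noteq> 0 \<and> keys p \<subseteq> X}"
      proof
        assume "x \<in> lead ` {p \<in> V. p \<noteq> 0 \<and> keys p \<subseteq> X}"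
        then obtain q :: "('n, 'a) mpoly" where "x = lead q" "q \<noteq> 0" "keys q \<subseteq> X" by blast
        then show False using \<open>x \<notin> X\<close> lead_in_keys[of q] by auto
      qed
      moreover have "finite (lead ` {p \<in> V. p \<noteq> 0 \<and> keys p \<subseteq> X})"
      proof (rule finite_subset[OF _ insert.hyps(1)], rule image_subsetI)
        fix q :: "('n, 'a) mpoly" assume "q \<in> {p \<in> V. p \<noteq> 0 \<and> keys p \<subseteq> X}"
        then show "lead q \<in> X" using lead_in_keys[of q] by auto
      qed
      ultimately show ?thesis using dim insert.IH by (simp add: scalar_dim)
    next
      case False
      then have "(\<lambda>v. lookup v x) ` ?V = {0}"
        using mpoly.subspace_0[OF sub] by force
      moreover have "?V = ?U" using False lead_U by auto
      then have "{p \<in> V. p \<noteq> 0 \<and> keys p \<subseteq> insert x X} = {p \<in> V. p \<noteq> 0 \<and> keys p \<subseteq> X}" by blast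
      ultimately show ?thesis using dim insert.IH by (simp add: scalar_dim)
    qed
  qed (use insert in \<open>simp add: insert_absorb\<close>)
qed

text \<open>An ideal is represented by the family of its homogeneous pieces, which is all that a
  Hilbert function sees.\<close>

definition graded_ideal :: "('n::finite \<Rightarrow> int) \<Rightarrow> (int \<Rightarrow> ('n, 'a::field) mpoly set) \<Rightarrow> bool" where
  "graded_ideal u W \<longleftrightarrow> (\<forall>j. mpoly.subspace (W j)) \<and> (\<forall>j. \<forall>p\<in>W j. whomog u j p) \<and>
     (\<forall>j d. \<forall>p\<in>W j. \<forall>q. whomog u d q \<longrightarrow> q * p \<in> W (d + j))"

lemma graded_ideal_mult: "graded_ideal u W \<Longrightarrow> whomog u d q \<Longrightarrow> p \<in> W j \<Longrightarrow> q * p \<in> W (d + j)"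
  unfolding graded_ideal_def by blast

definition lead_set :: "(int \<Rightarrow> ('n::finite, 'a::zero) mpoly set) \<Rightarrow> ('n \<Rightarrow>\<^sub>0 nat) set" where
  "lead_set W = {lead p | p j. p \<in> W j \<and> p \<noteq> 0}"

lemma mons_in_UNIV [simp]: "\<alpha> \<in> mons_in UNIV"
  by (simp add: mons_in_def)

lemma lead_monomial: "c \<noteq> 0 \<Longrightarrow> lead (single m c) = m"
  by (rule lead_eqI) auto

lemma single_eq_0_iff [simp]: "single m c = 0 \<longleftrightarrow> c = 0"
  by (metis lookup_single_eq lookup_zero single_zero)

lemma mon_ideal_lead_set:
  assumes "graded_ideal u W" shows "mon_ideal UNIV (lead_set W)"
  unfolding mon_ideal_def
proof (intro conjI ballI)
  fix \<alpha> \<gamma> assume "\<alpha> \<in> lead_set W"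
  then obtain p j where p: "p \<in> W j" "p \<noteq> 0" "\<alpha> = lead p" by (auto simp: lead_set_def)
  have "single \<gamma> 1 * p \<in> W (wdeg u \<gamma> + j)"
    using graded_ideal_mult[OF assms whomog_single p(1)] .
  moreover have "lead (single \<gamma> 1 * p) = \<alpha> + \<gamma>"
    using p by (simp add: lead_mult lead_monomial add.commute)
  moreover have "single \<gamma> 1 * p \<noteq> 0" using p by simp
  ultimately show "\<alpha> + \<gamma> \<in> lead_set W" unfolding lead_set_def by force
qed auto

text \<open>Macaulay's observation that an ideal and its initial ideal have the same Hilbert
  function; the elements of degree \<open>j\<close> involve only the finitely many monomials of that
  degree.\<close>

lemma dim_graded_ideal:
  assumes "\<And>i. u i > 0" "graded_ideal u W"
  shows "int (mpoly.dim (W j)) = mon_count u (lead_set W) j"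
proof -
  let ?X = "{\<alpha>. wdeg u \<alpha> = j}"
  have hom: "whomog u i p" if "p \<in> W i" for i p using assms(2) that by (auto simp: graded_ideal_def)
  have "{p \<in> W j. keys p \<subseteq> ?X} = W j" using hom[of _ j] by (auto simp: whomog_def)
  moreover have "{p \<in> W j. p \<noteq> 0 \<and> keys p \<subseteq> ?X} = {p \<in> W j. p \<noteq> 0}" using hom[of _ j] by (auto simp: whomog_def)
  ultimately have "mpoly.dim (W j) = card (lead ` {p \<in> W j. p \<noteq> 0})"
    using dim_eq_card_lead_bounded[of "W j" ?X] finite_wdeg_eq[of u j] assms by (simp add: graded_ideal_def)
  also have "lead ` {p \<in> W j. p \<noteq> 0} = {\<alpha> \<in> lead_set W. wdeg u \<alpha> = j}"
  proof (intro equalityI subsetI)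
    fix \<alpha> assume "\<alpha> \<in> {\<alpha> \<in> lead_set W. wdeg u \<alpha> = j}"
    then obtain p i where p: "p \<in> W i" "p \<noteq> 0" "\<alpha> = lead p" "wdeg u \<alpha> = j" by (auto simp: lead_set_def)
    then have "i = j" using hom[of p i] lead_in_keys[of p] by (auto simp: whomog_def)
    then show "\<alpha> \<in> lead ` {p \<in> W j. p \<noteq> 0}" using p by blast
  next
    fix \<alpha> assume "\<alpha> \<in> lead ` {p \<in> W j. p \<noteq> 0}"
    then obtain p where p: "p \<in> W j" "p \<noteq> 0" "\<alpha> = lead p" by blast
    then have "wdeg u \<alpha> = j" using hom[of p j] lead_in_keys[of p] by (auto simp: whomog_def)
    then show "\<alpha> \<in> {\<alpha> \<in> lead_set W. wdeg u \<alpha> = j}" using p by (auto simp: lead_set_def)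
  qed
  finally show ?thesis by (simp add: mon_count_def)
qed

abbreviation hilb_ideal :: "(int \<Rightarrow> ('n::finite, 'a::field) mpoly set) \<Rightarrow> int \<Rightarrow> int" where
  "hilb_ideal W \<equiv> \<lambda>j. int (mpoly.dim (W j))"

lemma graded_ideal_moments:
  fixes W :: "int \<Rightarrow> ('n::finite, 'a::field) mpoly set"
  assumes "\<And>i. u i > 0" "graded_ideal u W" "p \<in> W j" "p \<noteq> 0"
  shows "has_moments (num_on u UNIV (hilb_ideal W)) 1 (\<Sum>i\<in>UNIV. u i * int (min_exp (lead_set W) i))"
proof -
  have "lead_set W \<noteq> {}" using assms(3,4) by (auto simp: lead_set_def)
  moreover have "hilb_ideal W = mon_count u (lead_set W)"
    using dim_graded_ideal assms by blast
  ultimately show ?thesis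
    using mon_ideal_moments[of u UNIV "lead_set W"] mon_ideal_lead_set[OF assms(2)] assms(1) by simp
qed

section \<open>Principal ideals and ideals containing a coprime pair\<close>

definition multiples :: "('n::finite \<Rightarrow> int) \<Rightarrow> ('n, 'a::field) mpoly \<Rightarrow> int \<Rightarrow> ('n, 'a) mpoly set" where
  "multiples u g j = {p. g dvd p \<and> whomog u j p}"

lemma subspace_multiples: "mpoly.subspace (multiples u g j)"
  by (auto simp: mpoly.subspace_def multiples_def mscale_def intro: whomog_add whomog_scale)

lemma graded_ideal_multiples: "graded_ideal u (multiples u g)"
  unfolding graded_ideal_def using subspace_multiples
  by (auto simp: multiples_def intro: whomog_mult)

lemma multiples_in_span:
  assumes "\<And>i. u i > 0"
  shows "finite ((\<lambda>m. single m (1::'a::field)) ` {\<alpha>. wdeg u \<alpha> = j})"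
    "multiples u g j \<subseteq> mpoly.span ((\<lambda>m. single m 1) ` {\<alpha>. wdeg u \<alpha> = j})"
  using finite_wdeg_eq[of u j] assms
  by (auto simp: multiples_def whomog_def intro!: mpoly_in_span_monomials)

text \<open>The leading monomials of the ideal are exactly the multiples of \<open>lead g\<close>,
  so their greatest common divisor is \<open>lead g\<close>, of degree \<open>a\<close>.\<close>

lemma multiples_moments:
  fixes g :: "('n::finite, 'a::field) mpoly"
  assumes u: "\<And>i. u i > 0" and g: "whomog u a g" "g \<noteq> 0"
  shows "has_moments (num_on u UNIV (hilb_ideal (multiples u g))) 1 a"
proof -
  have mul: "single m 1 * g \<in> multiples u g (wdeg u m + a)" for m
    using g whomog_mult[OF whomog_single] by (auto simp: multiples_def)
  have ls: "lead_set (multiples u g) = {lead g + m | m. True}"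
  proof (intro equalityI subsetI)
    fix \<alpha> assume "\<alpha> \<in> lead_set (multiples u g)"
    then obtain q where "g * q \<noteq> 0" "\<alpha> = lead (g * q)"
      by (auto simp: lead_set_def multiples_def elim!: dvdE)
    then show "\<alpha> \<in> {lead g + m | m. True}" using lead_mult[of g q] by auto
  next
    fix \<alpha> assume "\<alpha> \<in> {lead g + m | m. True}"
    then obtain m where "\<alpha> = lead (single m 1 * g)"
      using g(2) lead_mult[of "single m 1" g for m] by (auto simp: lead_monomial add.commute)
    then show "\<alpha> \<in> lead_set (multiples u g)"
      unfolding lead_set_def using mul[of m] g(2) by force
  qed
  have "min_exp (lead_set (multiples u g)) i = lookup (lead g) i" for i
  proof (rule antisym)
    have "lead g \<in> lead_set (multiples u g)" unfolding ls by (rule CollectI, rule exI[of _ 0]) simp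
    then show "min_exp (lead_set (multiples u g)) i \<le> lookup (lead g) i" by (rule min_exp_le)
    obtain \<alpha> where "\<alpha> \<in> lead_set (multiples u g)" "lookup \<alpha> i = min_exp (lead_set (multiples u g)) i"
      using min_exp_attained[of "lead_set (multiples u g)"] \<open>lead g \<in> _\<close> by blast
    then show "lookup (lead g) i \<le> min_exp (lead_set (multiples u g)) i"
      unfolding ls by (auto simp: lookup_add)
  qed
  then have "(\<Sum>i\<in>UNIV. u i * int (min_exp (lead_set (multiples u g)) i)) = wdeg u (lead g)"
    by (simp add: wdeg_def)
  also have "\<dots> = a" using g lead_in_keys[of g] by (auto simp: whomog_def)
  finally show ?thesis
    using graded_ideal_moments[OF u graded_ideal_multiples mul, of 0] g(2) by simp
qed

text \<open>An ideal containing a regular sequence of length two has no divisorial part: it is squeezed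
  between the complete intersection \<open>(g, h)\<close>, whose numerator is \<open>t^a + t^b - t^(a+b)\<close>, and the
  whole ring.\<close>

lemma coprime_pair_moments:
  fixes W :: "int \<Rightarrow> ('n::finite, 'a::field) mpoly set"
  assumes u: "\<And>i. u i > 0" and W: "graded_ideal u W"
    and g: "g \<in> W a" "g \<noteq> 0" and h: "h \<in> W b" "h \<noteq> 0"
    and coprime: "\<And>p. g dvd p \<Longrightarrow> h dvd p \<Longrightarrow> g * h dvd p"
  shows "has_moments (num_on u UNIV (hilb_ideal W)) 1 0"
proof -
  let ?V = "\<lambda>j. {p + q | p q. p \<in> multiples u g j \<and> q \<in> multiples u h j}"
  have hom: "whomog u a g" "whomog u b h" using W g h by (auto simp: graded_ideal_def)
  have dims: "hilb_ideal ?V = (\<lambda>j. hilb_ideal (multiples u g) j + hilb_ideal (multiples u h) j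
      - hilb_ideal (multiples u (g * h)) j)"
  proof
    fix j
    \<comment> \<open>Coprimality makes \<open>g * h\<close> generate the intersection of the two
      principal ideals; the dimension formula for the identity map then becomes
      inclusion-exclusion.\<close>
    have "{p \<in> multiples u g j. p \<in> multiples u h j} = multiples u (g * h) j"
      using coprime by (auto simp: multiples_def intro: dvd_mult_left dvd_mult_right)
    then have "mpoly.dim (multiples u g j) + mpoly.dim (multiples u h j)
        = mpoly.dim (?V j) + mpoly.dim (multiples u (g * h) j)"
      using mpoly_mpoly.dim_image_plus[OF mpoly.linear_ident subspace_multiples[of u g j]
          subspace_multiples[of u h j] multiples_in_span[OF u] multiples_in_span[OF u]] by simp
    then show "hilb_ideal ?V j = hilb_ideal (multiples u g) j + hilb_ideal (multiples u h) j
      - hilb_ideal (multiples u (g * h)) j" by simp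
  qed
  have V1: "has_moments (num_on u UNIV (hilb_ideal ?V)) 1 0"
  proof -
    have "num_on u UNIV (hilb_ideal ?V) = (\<lambda>m. num_on u UNIV (hilb_ideal (multiples u g)) m
        + num_on u UNIV (hilb_ideal (multiples u h)) m - num_on u UNIV (hilb_ideal (multiples u (g * h))) m)"
      unfolding dims num_on_diff num_on_add ..
    moreover have "g * h \<noteq> 0" using g h by simp
    ultimately show ?thesis
      using has_moments_diff[OF has_moments_add[OF multiples_moments[OF u hom(1) g(2)]
            multiples_moments[OF u hom(2) h(2)]] multiples_moments[OF u whomog_mult[OF hom]]]
      by simp
  qed
  have V: "graded_ideal u ?V"
    unfolding graded_ideal_def
  proof (intro conjI allI ballI impI)
    fix j
    show "mpoly.subspace (?V j)"
      using mpoly.subspace_sums[OF subspace_multiples[of u g j] subspace_multiples[of u h j]] by simp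
    fix p assume p: "p \<in> ?V j"
    then show "whomog u j p" by (auto simp: multiples_def intro: whomog_add)
    fix d and q :: "('n, 'a) mpoly" assume "whomog u d q"
    then show "q * p \<in> ?V (d + j)"
      using p graded_ideal_multiples[of u g] graded_ideal_multiples[of u h]
      by (fastforce simp: graded_ideal_def distrib_left)
  qed
  have "g = g + 0 \<and> g \<in> multiples u g a \<and> 0 \<in> multiples u h a"
    using hom by (auto simp: multiples_def)
  then have gV: "g \<in> ?V a" by blast
  \<comment> \<open>Closure of \<open>W\<close> is stated for homogeneous multipliers, so the
    cofactor of \<open>f\<close> in a homogeneous multiple must first be seen to be
    homogeneous.\<close>
  have mul: "p \<in> W j" if p: "p \<in> multiples u f j" "f \<in> W c" "whomog u c f" "f \<noteq> 0" for p f j c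
  proof (cases "p = 0")
    case True
    then show ?thesis using W by (simp add: graded_ideal_def mpoly.subspace_0)
  next
    case False
    have "f dvd p" using p(1) by (simp add: multiples_def)
    then obtain q where q: "p = q * f" by (metis dvdE mult.commute)
    have "whomog u (maxdeg u q) q"
      using p(1) False q by (intro whomog_factor[of u j q f]) (auto simp: multiples_def)
    then have *: "q * f \<in> W (maxdeg u q + c)" using W p(2) by (auto simp: graded_ideal_def)
    then have "maxdeg u q + c = j"
      using W p(1) False q whomog_unique[of u "maxdeg u q + c" p j]
      by (auto simp: graded_ideal_def multiples_def)
    then show ?thesis using * q by simp
  qed
  have "?V j \<subseteq> W j" for j
    using mul[OF _ g(1) hom(1) g(2)] mul[OF _ h(1) hom(2) h(2)] W
    by (auto simp: graded_ideal_def intro!: mpoly.subspace_add)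
  then have sub: "lead_set ?V \<subseteq> lead_set W" unfolding lead_set_def by blast
  have ne: "lead_set ?V \<noteq> {}" using gV g(2) unfolding lead_set_def by blast
  let ?w = "\<lambda>W. \<Sum>i\<in>UNIV. u i * int (min_exp (lead_set W) i)"
  \<comment> \<open>The first moment of the complete intersection is a + b - (a + b) = 0. A larger
    ideal has smaller minimal exponents, and these are nonnegative, so the sum for \<open>W\<close>
    is squeezed to 0.\<close>
  have "?w ?V = 0"
    using V1 graded_ideal_moments[OF u V gV g(2)] by (simp add: has_moments_def)
  moreover have "?w W \<le> ?w ?V"
    using u min_exp_mono[OF ne sub] by (intro sum_mono mult_left_mono) (auto simp: less_imp_le)
  moreover have "?w W \<ge> 0"
    using u by (intro sum_nonneg mult_nonneg_nonneg) (auto simp: less_imp_le)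
  ultimately show ?thesis
    using graded_ideal_moments[OF u W g] by simp
qed

section \<open>Logarithmic derivations\<close>

interpretation der: vector_space
  "der_scale :: 'a::field \<Rightarrow> ('n::finite \<Rightarrow> ('n, 'a) mpoly) \<Rightarrow> ('n \<Rightarrow> ('n, 'a) mpoly)"
  by unfold_locales
    (simp_all add: der_scale_def fun_eq_iff algebra_simps single_add mult_single flip: mult.assoc)

interpretation der_mpoly: vector_space_pair
  "der_scale :: 'a::field \<Rightarrow> ('n::finite \<Rightarrow> ('n, 'a) mpoly) \<Rightarrow> ('n \<Rightarrow> ('n, 'a) mpoly)"
  "mscale :: 'a \<Rightarrow> ('n, 'a) mpoly \<Rightarrow> ('n, 'a) mpoly" ..

section \<open>Multiplicities of irreducible factors\<close>

lemma maxdeg_power: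
  fixes p :: "('n::finite, 'a::idom) mpoly"
  assumes "p \<noteq> 0" shows "maxdeg w (p ^ e) = int e * maxdeg w p"
proof (induction e)
  case 0
  have "maxdeg w (1 :: ('n, 'a) mpoly) = 0" by (rule maxdeg_eq_whomog) auto
  then show ?case by simp
next
  case (Suc e)
  then show ?case using maxdeg_mult[of p "p ^ e" w] assms by (simp add: algebra_simps)
qed

lemma irreducible_tdeg_pos:
  fixes p :: "('n::finite, 'a::field) mpoly"
  assumes "irreducible p" shows "tdeg p > 0"
proof -
  have "p \<noteq> 0" "tdeg p \<noteq> 0" using assms by (auto simp: irreducible_def mpoly_unit_iff)
  moreover from this have "tdeg p \<ge> 0" by (intro maxdeg_nonneg) auto
  ultimately show ?thesis by simp
qed

text \<open>An irreducible polynomial has positive total degree, so the degree of \<open>f\<close>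
  bounds the exponent. Hence \<open>mult_in g f\<close> is a true maximum and not the default
  0.\<close>

lemma finite_exponents_dvd:
  fixes g f :: "('n::finite, 'a::field) mpoly"
  assumes "irreducible g" "f \<noteq> 0"
  shows "finite {e. g ^ e dvd f}"
proof (rule finite_subset)
  show "{e. g ^ e dvd f} \<subseteq> {..nat (tdeg f)}"
  proof
    fix e assume "e \<in> {e. g ^ e dvd f}"
    then obtain q where q: "f = g ^ e * q" by (auto elim: dvdE)
    have nz: "g \<noteq> 0" "g ^ e \<noteq> 0" "q \<noteq> 0" using q assms by auto
    have "tdeg f = int e * tdeg g + tdeg q"
      unfolding q maxdeg_mult[OF nz(2,3)] maxdeg_power[OF nz(1)] ..
    moreover have "int e * 1 \<le> int e * tdeg g"
      using irreducible_tdeg_pos[OF assms(1)] by (intro mult_left_mono) auto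
    moreover have "tdeg q \<ge> 0" using nz by (intro maxdeg_nonneg) auto
    ultimately show "e \<in> {..nat (tdeg f)}" by simp
  qed
qed simp

lemma
  fixes g f :: "('n::finite, 'a::field) mpoly"
  assumes "irreducible g" "f \<noteq> 0"
  shows power_mult_in_dvd: "g ^ mult_in g f dvd f"
    and le_mult_in: "g ^ e dvd f \<Longrightarrow> e \<le> mult_in g f"
proof -
  note fin = finite_exponents_dvd[OF assms]
  have "0 \<in> {e. g ^ e dvd f}" by simp
  then have "Max {e. g ^ e dvd f} \<in> {e. g ^ e dvd f}" using fin by (intro Max_in) blast+
  then show "g ^ mult_in g f dvd f" using fin by (simp add: mult_in_def)
  show "e \<le> mult_in g f" if "g ^ e dvd f"
    using that fin by (simp add: mult_in_def)
qed

lemma irreducible_power_dvd_cancel: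
  fixes f h x :: "('n::finite, 'a::field) mpoly"
  assumes "irreducible f" "\<not> f dvd h" "f ^ e dvd h * x"
  shows "f ^ e dvd x"
  using assms(3)
proof (induction e arbitrary: x)
  case (Suc e)
  have f0: "f \<noteq> 0" using assms(1) by auto
  have "f dvd h * x" using Suc.prems by (metis dvd_mult_left power_Suc)
  then obtain x' where x': "x = f * x'"
    using mpoly_irreducible_prime[OF assms(1)] assms(2) by blast
  then have "f * f ^ e dvd f * (h * x')" using Suc.prems by (simp add: mult.left_commute)
  then have "f ^ e dvd h * x'" using mpoly_dvd_mult_cancel_left[OF f0] by blast
  then have "f ^ e dvd x'" by (rule Suc.IH)
  then show ?case using f0 by (simp add: x' mpoly_dvd_mult_cancel_left)
qed simp

lemma irreducible_dvd_power:
  fixes f p :: "('n::finite, 'a::field) mpoly"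
  assumes "irreducible f" "f dvd p ^ e" shows "f dvd p"
  using assms(2)
proof (induction e)
  case 0
  then show ?case using assms(1) by (simp add: irreducible_def)
qed (use mpoly_irreducible_prime[OF assms(1)] in auto)

lemma irreducible_dvd_irreducible:
  fixes f p :: "('n::finite, 'a::field) mpoly"
  assumes "irreducible f" "irreducible p" "f dvd p"
  obtains c where "c \<noteq> 0" "f = single 0 c * p"
proof -
  obtain w where w: "p = f * w" using assms(3) by auto
  then have "w dvd 1" using irreducibleD[OF assms(2) w] assms(1) by (auto simp: irreducible_def)
  then obtain c where c: "c \<noteq> 0" "w = single 0 c" by (rule mpoly_unitE)
  have "single 0 (inverse c) * p = f * (single 0 (inverse c) * single 0 c)"
    unfolding w c(2) by (simp only: mult_ac)
  then have "f = single 0 (inverse c) * p" using c(1) by (simp add: mult_single)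
  then show ?thesis using c(1) that[of "inverse c"] by simp
qed

section \<open>Partial derivatives\<close>

lemma pderiv_var_scale:
  fixes p :: "('n::finite, 'a::field) mpoly"
  assumes "c \<noteq> 0"
  shows "pderiv_var i (single 0 c * p) = single 0 c * pderiv_var i p"
proof -
  have "keys (single 0 c * p) = keys p" using assms by (auto simp: in_keys_iff)
  moreover have "single (m - single i 1) (of_nat (lookup m i) * lookup (single 0 c * p) m)
      = single 0 c * single (m - single i 1) (of_nat (lookup m i) * lookup p m)" for m
    unfolding lookup_single_zero_mult mult_single by (simp only: mult.left_commute add_0)
  ultimately show ?thesis
    unfolding pderiv_var_def sum_distrib_left by (simp only:)
qed

lemma whomog_pderiv_var:
  fixes p :: "('n::finite, 'a::comm_ring_1) mpoly"
  assumes "whomog u d p"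
  shows "whomog u (d - u i) (pderiv_var i p)"
  unfolding pderiv_var_def
proof (rule whomog_sum)
  fix m assume m: "m \<in> keys p"
  show "whomog u (d - u i) (single (m - single i 1) (of_nat (lookup m i) * lookup p m))"
  \<comment> \<open>If the exponent is 0, truncated subtraction leaves \<open>m\<close> unchanged
    and of the wrong degree, but the coefficient \<open>of_nat 0\<close> removes the term.\<close>
  proof (cases "lookup m i = 0")
    case False
    then have "m - single i 1 + single i 1 = m" by (intro add_single_minus) simp
    then have "wdeg u m = wdeg u (m - single i 1) + u i"
      using wdeg_add[of u "m - single i 1" "single i 1"] by simp
    then have "wdeg u (m - single i 1) = d - u i" using m assms by (simp add: whomog_def)
    then show ?thesis using whomog_single by metis
  qed simp
qed

text \<open>Monomials with positive exponent of \<open>i\<close> stay distinct after lowering it,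
  and those with exponent 0 get coefficient 0. So the term of \<open>m\<close> survives, with a
  coefficient that is nonzero in characteristic zero.\<close>

lemma pderiv_var_nonzero:
  fixes p :: "('n::finite, 'a::field_char_0) mpoly"
  assumes "m \<in> keys p" "lookup m i \<noteq> 0"
  shows "pderiv_var i p \<noteq> 0"
proof
  assume 0: "pderiv_var i p = 0"
  have m: "m - single i 1 + single i 1 = m" using assms(2) by (intro add_single_minus) simp
  have "(if m' - single i 1 = m - single i 1 then of_nat (lookup m' i) * lookup p m' else 0)
      = (if m' = m then of_nat (lookup m i) * lookup p m else 0)" for m'
  proof (cases "lookup m' i = 0")
    case False
    then have "m' - single i 1 + single i 1 = m'" by (intro add_single_minus) simp
    then have "m' - single i 1 = m - single i 1 \<longleftrightarrow> m' = m" using m by metis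
    then show ?thesis by simp
  qed (use assms(2) in auto)
  then have "lookup (pderiv_var i p) (m - single i 1) =
      (\<Sum>m'\<in>keys p. if m' = m then of_nat (lookup m i) * lookup p m else 0)"
    by (simp add: pderiv_var_def lookup_sum lookup_single when_def)
  then have "of_nat (lookup m i) * lookup p m = 0" using 0 assms(1) by simp
  then show False using assms by (simp add: in_keys_iff)
qed

text \<open>Positive total degree gives a variable \<open>i\<close> occurring in \<open>p\<close>.
  The derivative is homogeneous of degree \<open>b - u i\<close>, whereas a nonzero multiple of
  \<open>p\<close> has degree at least \<open>b\<close>.\<close>

lemma irreducible_not_dvd_pderiv:
  fixes p :: "('n::finite, 'a::field_char_0) mpoly"
  assumes u: "\<And>i. u i > 0" and p: "irreducible p" "whomog u b p"
  obtains i where "pderiv_var i p \<noteq> 0" "\<not> p dvd pderiv_var i p"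
proof -
  have p0: "p \<noteq> 0" using p by auto
  obtain m where m: "m \<in> keys p" "wdeg (\<lambda>_. 1) m = tdeg p" using maxdeg_attained[OF p0] by blast
  then have "m \<noteq> 0" using irreducible_tdeg_pos[OF p(1)] by auto
  then obtain i where i: "lookup m i \<noteq> 0" by (metis lookup_zero poly_mapping_eqI)
  have nz: "pderiv_var i p \<noteq> 0" using pderiv_var_nonzero[OF m(1) i] .
  moreover have "\<not> p dvd pderiv_var i p"
  proof
    assume "p dvd pderiv_var i p"
    then obtain s where s: "pderiv_var i p = p * s" by auto
    then have s0: "s \<noteq> 0" using nz by auto
    have "maxdeg u (pderiv_var i p) = b - u i" using nz whomog_pderiv_var[OF p(2)] by (intro maxdeg_eq_whomog)
    moreover have "maxdeg u p = b" using p0 p(2) by (intro maxdeg_eq_whomog)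
    moreover have "maxdeg u s \<ge> 0" using s0 u by (intro maxdeg_nonneg) (auto simp: less_imp_le)
    ultimately show False using maxdeg_mult[OF p0 s0, of u] u[of i] unfolding s by simp
  qed
  ultimately show ?thesis using that by blast
qed

section \<open>Graded pieces of the module of logarithmic derivations\<close>

lemma der_apply_add: "der_apply (a + b) g = der_apply a g + der_apply b g"
  by (simp add: der_apply_def distrib_right sum.distrib)

lemma der_apply_mult: "der_apply (\<lambda>i. q * a i) g = q * der_apply a g"
  by (simp add: der_apply_def sum_distrib_left mult.assoc)

lemma der_apply_scale: "der_apply (der_scale c a) g = mscale c (der_apply a g)"
  by (simp add: der_scale_def mscale_def der_apply_mult)

lemma der_apply_zero [simp]: "der_apply 0 g = 0"
  by (simp add: der_apply_def)

lemma linear_der_apply: "Vector_Spaces.linear der_scale mscale (\<lambda>a. der_apply a g)"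
  for g :: "('n::finite, 'a::field) mpoly"
  unfolding Vector_Spaces.linear_iff
  by (simp add: der_apply_add der_apply_scale der.vector_space_axioms mpoly.vector_space_axioms)

lemma whomog_der_apply:
  fixes g :: "('n::finite, 'a::comm_ring_1) mpoly"
  assumes "\<And>i. whomog u (j - v i) (a i)" "whomog u b g" "\<And>i. u i + v i = k"
  shows "whomog u (j - k + b) (der_apply a g)"
  unfolding der_apply_def
proof (rule whomog_sum)
  fix i
  have "j - v i + (b - u i) = j - k + b" using assms(3)[of i] by simp
  then show "whomog u (j - k + b) (a i * pderiv_var i g)"
    using whomog_mult[OF assms(1) whomog_pderiv_var[OF assms(2)]] by metis
qed

lemma Der_log_mult: "a \<in> Der_log Q \<Longrightarrow> (\<lambda>i. q * a i) \<in> Der_log Q"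
  by (auto simp: Der_log_def Der_mult_def der_apply_mult)

lemma Der_log_add: "a \<in> Der_log Q \<Longrightarrow> b \<in> Der_log Q \<Longrightarrow> a + b \<in> Der_log Q"
  by (auto simp: Der_log_def Der_mult_def der_apply_add)

lemma Der_log_zero: "0 \<in> Der_log Q"
  by (simp add: Der_log_def Der_mult_def)

lemma subspace_Der_piece: "der.subspace (Der_piece u v Q j)"
  unfolding der.subspace_def
proof (intro conjI ballI allI)
  show "0 \<in> Der_piece u v Q j" by (simp add: Der_piece_def Der_log_zero)
  show "a + b \<in> Der_piece u v Q j" if "a \<in> Der_piece u v Q j" "b \<in> Der_piece u v Q j" for a b
    using that by (auto simp: Der_piece_def intro: Der_log_add whomog_add)
  show "der_scale c a \<in> Der_piece u v Q j" if "a \<in> Der_piece u v Q j" for c a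
    using that by (auto simp: Der_piece_def der_scale_def intro: Der_log_mult whomog_scale)
qed

definition unit_der :: "'n \<Rightarrow> ('n, 'a::comm_ring_1) mpoly \<Rightarrow> 'n \<Rightarrow> ('n, 'a) mpoly" where
  "unit_der i q = (\<lambda>l. if l = i then q else 0)"

lemma der_apply_unit_der: "der_apply (unit_der i q) g = q * pderiv_var i g"
proof -
  have "der_apply (unit_der i q) g = (\<Sum>l\<in>UNIV. if l = i then q * pderiv_var l g else 0)"
    unfolding der_apply_def unit_der_def by (intro sum.cong) auto
  then show ?thesis by simp
qed

lemma sum_function_apply: "(\<Sum>i\<in>I. f i) x = (\<Sum>i\<in>I. f i x)"
  by (induction I rule: infinite_finite_induct) auto

text \<open>The spanning set consists of the derivations x^m \<partial>_i of the right degree; for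
  positive weights it is finite, as the dimension formula requires.\<close>

lemma homogeneous_der_in_span:
  fixes a :: "'n::finite \<Rightarrow> ('n, 'a::field) mpoly"
  assumes "\<And>i. whomog u (j - v i) (a i)"
  shows "a \<in> der.span (\<Union>i. (\<lambda>m. unit_der i (single m 1)) ` {m. wdeg u m = j - v i})"
proof -
  have "a = (\<Sum>i\<in>UNIV. \<Sum>m\<in>keys (a i). der_scale (lookup (a i) m) (unit_der i (single m 1)))"
  proof
    fix l
    have "(\<Sum>i\<in>UNIV. \<Sum>m\<in>keys (a i). der_scale (lookup (a i) m) (unit_der i (single m 1))) l
        = (\<Sum>i\<in>UNIV. \<Sum>m\<in>keys (a i). der_scale (lookup (a i) m) (unit_der i (single m 1)) l)"
      by (simp add: sum_function_apply)
    also have "\<dots> = (\<Sum>i\<in>UNIV. if i = l then \<Sum>m\<in>keys (a i). single m (lookup (a i) m) else 0)"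
      by (intro sum.cong refl) (auto simp: der_scale_def unit_der_def mult_single)
    also have "\<dots> = a l" using poly_mapping_sum_singles[of "a l"] by simp
    finally show "a l = (\<Sum>i\<in>UNIV. \<Sum>m\<in>keys (a i). der_scale (lookup (a i) m) (unit_der i (single m 1))) l"
      by simp
  qed
  also have "\<dots> \<in> der.span (\<Union>i. (\<lambda>m. unit_der i (single m 1)) ` {m. wdeg u m = j - v i})"
    using assms by (intro der.span_sum der.span_scale der.span_base) (auto simp: whomog_def)
  finally show ?thesis .
qed

lemma finite_homogeneous_der_basis:
  assumes "\<And>i. u i > 0"
  shows "finite (\<Union>i::'n::finite. (\<lambda>m. unit_der i (single m (1::'a::field))) ` {m. wdeg u m = j - v i})"
  using finite_wdeg_eq[of u] assms by auto

lemma dim_homogeneous_ders: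
  fixes u v :: "'n::finite \<Rightarrow> int"
  assumes u: "\<And>i. u i > 0" and "finite A"
  shows "der.dim {a :: 'n \<Rightarrow> ('n, 'a::field) mpoly. \<forall>i. whomog u (j - v i) (a i) \<and> (i \<notin> A \<longrightarrow> a i = 0)}
    = (\<Sum>i\<in>A. mpoly.dim (multiples u (1 :: ('n, 'a) mpoly) (j - v i)))"
  using assms(2)
proof (induction A rule: finite_induct)
  case empty
  have "{a :: 'n \<Rightarrow> ('n, 'a) mpoly. \<forall>i. whomog u (j - v i) (a i) \<and> (i \<notin> {} \<longrightarrow> a i = 0)} = {0}"
    by (auto simp: fun_eq_iff)
  moreover have "card ({} :: ('n \<Rightarrow> ('n, 'a) mpoly) set) = der.dim {0 :: 'n \<Rightarrow> ('n, 'a) mpoly}"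
    by (intro der.basis_card_eq_dim der.independent_empty) auto
  ultimately show ?case by simp
next
  case (insert x A)
  let ?D = "\<lambda>A. {a :: 'n \<Rightarrow> ('n, 'a) mpoly. \<forall>i. whomog u (j - v i) (a i) \<and> (i \<notin> A \<longrightarrow> a i = 0)}"
  have sub: "der.subspace (?D (insert x A))"
    by (auto simp: der.subspace_def der_scale_def intro: whomog_add whomog_scale)
  have lin: "Vector_Spaces.linear der_scale mscale (\<lambda>a :: 'n \<Rightarrow> ('n, 'a) mpoly. a x)"
    unfolding Vector_Spaces.linear_iff
    by (simp add: der_scale_def mscale_def der.vector_space_axioms mpoly.vector_space_axioms)
  have span: "?D (insert x A) \<subseteq> der.span (\<Union>i. (\<lambda>m. unit_der i (single m 1)) ` {m. wdeg u m = j - v i})"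
    using homogeneous_der_in_span by blast
  have "der.dim (?D (insert x A)) + mpoly.dim {0 :: ('n, 'a) mpoly} =
      mpoly.dim {a x + n | a n. a \<in> ?D (insert x A) \<and> n \<in> {0}} + der.dim {a \<in> ?D (insert x A). a x \<in> {0}}"
    using der_mpoly.dim_image_plus[OF lin sub mpoly.subspace_single_0
        finite_homogeneous_der_basis[OF u] span finite.emptyI] by simp
  moreover have "mpoly.dim {0 :: ('n, 'a) mpoly} = 0"
    using mpoly.basis_card_eq_dim[OF _ _ mpoly.independent_empty, of "{0 :: ('n, 'a) mpoly}"] by simp
  moreover have "{a \<in> ?D (insert x A). a x \<in> {0}} = ?D A"
    using insert.hyps(2) by auto
  moreover have "{a x + n | a n. a \<in> ?D (insert x A) \<and> n \<in> {0}} = multiples u 1 (j - v x)"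
  proof (intro equalityI subsetI)
    fix p assume "p \<in> {a x + n | a n. a \<in> ?D (insert x A) \<and> n \<in> {0}}"
    then show "p \<in> multiples u 1 (j - v x)" by (auto simp: multiples_def)
  next
    fix p :: "('n, 'a) mpoly" assume "p \<in> multiples u 1 (j - v x)"
    then have "unit_der x p \<in> ?D (insert x A) \<and> unit_der x p x + 0 = p"
      by (auto simp: multiples_def unit_der_def)
    then show "p \<in> {a x + n | a n. a \<in> ?D (insert x A) \<and> n \<in> {0}}"
      by (intro CollectI exI[of _ "unit_der x p"] exI[of _ 0]) auto
  qed
  ultimately show ?case using insert by simp
qed

text \<open>By primality, an irreducible \<open>g\<close> not dividing \<open>p\<close> divides
  \<open>Q\<close> to the same order as \<open>Q'\<close>. One that divides \<open>p\<close> is a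
  scalar multiple of \<open>p\<close>, and scaling changes neither multiplicities nor the
  divisibility condition.\<close>

lemma Der_log_split:
  fixes Q :: "('n::finite, 'a::field) mpoly"
  assumes "Q \<noteq> 0" "irreducible p" "Q = p ^ mult_in p Q * Q'"
  shows "Der_log Q = Der_log Q' \<inter> Der_mult p (mult_in p Q)"
proof (intro equalityI subsetI)
  have pQ': "p ^ mult_in p Q \<noteq> 0" "Q' \<noteq> 0" using assms(1,3) by (metis mult_zero_left mult_zero_right)+
  note prime = mpoly_irreducible_prime
  {
    fix a assume a: "a \<in> Der_log Q"
    have "a \<in> Der_mult g (mult_in g Q')" if g: "irreducible g" "g dvd Q'" for g
    proof -
      have "g ^ mult_in g Q' dvd Q"
        using power_mult_in_dvd[OF g(1) pQ'(2)] assms(3) by (metis dvd_mult)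
      then have "g ^ mult_in g Q' dvd g ^ mult_in g Q"
        using le_mult_in[OF g(1) assms(1)] by (intro le_imp_power_dvd)
      moreover have "g dvd Q" using g(2) assms(3) by (metis dvd_mult)
      ultimately show ?thesis using a g(1) by (auto simp: Der_log_def Der_mult_def intro: dvd_trans)
    qed
    moreover have "a \<in> Der_mult p (mult_in p Q)" if "p dvd Q" using a assms(2) that by (auto simp: Der_log_def)
    \<comment> \<open>In this case \<open>Der_mult p 0\<close> contains every derivation, since the
      zeroth power is 1.\<close>
    moreover have "mult_in p Q = 0" if "\<not> p dvd Q"
      using that power_mult_in_dvd[OF assms(2,1)] by (metis dvd_power dvd_trans not_gr_zero)
    ultimately show "a \<in> Der_log Q' \<inter> Der_mult p (mult_in p Q)"
      by (cases "p dvd Q") (auto simp: Der_log_def Der_mult_def)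
  next
    fix a assume a: "a \<in> Der_log Q' \<inter> Der_mult p (mult_in p Q)"
    show "a \<in> Der_log Q"
      unfolding Der_log_def
    proof (intro CollectI allI impI)
      fix g assume "irreducible g \<and> g dvd Q"
      then have g: "irreducible g" "g dvd Q" by auto
      show "a \<in> Der_mult g (mult_in g Q)"
      proof (cases "g dvd p")
        case True
        then obtain c where c: "c \<noteq> 0" "g = single 0 c * p"
          using irreducible_dvd_irreducible[OF g(1) assms(2)] by blast
        have pg: "p dvd g" using c(2) by simp
        have "p ^ e dvd x \<longleftrightarrow> g ^ e dvd x" for e x
          using True pg by (meson dvd_power_same dvd_trans)
        moreover from this have "mult_in g Q = mult_in p Q" by (simp add: mult_in_def)
        moreover have "der_apply a g = single 0 c * der_apply a p"
          unfolding c(2) der_apply_def sum_distrib_left pderiv_var_scale[OF c(1)] by (simp only: mult_ac)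
        ultimately show ?thesis using a by (simp add: Der_mult_def)
      next
        case False
        have not: "\<not> g dvd p ^ mult_in p Q" using False irreducible_dvd_power[OF g(1)] by blast
        have "g dvd Q'" using g prime[OF g(1)] not assms(3) by metis
        have "g ^ mult_in g Q dvd p ^ mult_in p Q * Q'"
          using power_mult_in_dvd[OF g(1) assms(1)] assms(3) by simp
        then have "g ^ mult_in g Q dvd Q'" by (rule irreducible_power_dvd_cancel[OF g(1) not])
        then have "g ^ mult_in g Q dvd g ^ mult_in g Q'"
          using le_mult_in[OF g(1) pQ'(2)] by (intro le_imp_power_dvd)
        then show ?thesis
          using a g(1) \<open>g dvd Q'\<close> by (auto simp: Der_log_def Der_mult_def intro: dvd_trans)
      qed
    qed
  }
qed

lemma Der_piece_split_moments:
  fixes u v :: "'n::finite \<Rightarrow> int" and Q :: "('n, 'a::field_char_0) mpoly"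
  assumes u: "\<And>i. u i > 0" and k: "\<And>i. u i + v i = k"
    and Q: "Q \<noteq> 0" "Q = p ^ e * Q'" "e = mult_in p Q" and p: "irreducible p" "whomog u b p"
    and Q': "whomog u d' Q'" "\<not> p dvd Q'"
    and M: "has_moments (num_on u UNIV (\<lambda>j. int (hilb u v Q' j))) r c"
  shows "has_moments (num_on u UNIV (\<lambda>j. int (hilb u v Q j))) r (c + int e * b)"
proof -
  \<comment> \<open>The pieces of the ideal J: \<delta> \<mapsto> \<delta>(p) lowers degrees by
    \<open>k - b\<close>, so degree \<open>j\<close> of J comes from derivations of degree
    \<open>j + k - b\<close>.\<close>
  define W where "W j = {der_apply a p + n | a n. a \<in> Der_piece u v Q' (j + k - b) \<and> n \<in> multiples u (p ^ e) j}" for j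
  have p0: "p \<noteq> 0" using p(1) by auto
  have Q'0: "Q' \<noteq> 0" using Q(1,2) by (metis mult_zero_right)
  have pe: "whomog u (int e * b) (p ^ e)" using p(2) by (rule whomog_power)
  have pe0: "p ^ e \<noteq> 0" using p0 by simp
  have hom: "whomog u j (der_apply a p)" if "a \<in> Der_piece u v Q' (j + k - b)" for a j
    using that whomog_der_apply[of u "j + k - b" v a b p k] k p(2) by (simp add: Der_piece_def)
  have mult_piece: "(\<lambda>i. q * a i) \<in> Der_piece u v Q' (d + j)"
    if "a \<in> Der_piece u v Q' j" "whomog u d q" for a q d j
    using that whomog_mult[OF that(2)] by (fastforce simp: Der_piece_def Der_log_mult add_diff_eq)
  have dims: "int (hilb u v Q j) = int (hilb u v Q' j) + hilb_ideal (multiples u (p ^ e)) (j - (k - b))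
      - hilb_ideal W (j - (k - b))" for j
  proof -
    let ?V = "Der_piece u v Q' j" and ?N = "multiples u (p ^ e) (j - (k - b))"
    have "der.dim ?V + mpoly.dim ?N = mpoly.dim {der_apply a p + n | a n. a \<in> ?V \<and> n \<in> ?N}
        + der.dim {a \<in> ?V. der_apply a p \<in> ?N}"
    proof (rule der_mpoly.dim_image_plus[OF linear_der_apply subspace_Der_piece subspace_multiples
          finite_homogeneous_der_basis[OF u] _ multiples_in_span[OF u]])
      show "?V \<subseteq> der.span (\<Union>i. (\<lambda>m. unit_der i (single m 1)) ` {m. wdeg u m = j - v i})"
        using homogeneous_der_in_span by (auto simp: Der_piece_def)
    qed
    moreover have "{a \<in> ?V. der_apply a p \<in> ?N} = Der_piece u v Q j"
    proof -
      have "Der_log Q = Der_log Q' \<inter> Der_mult p e"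
        using Der_log_split[OF Q(1) p(1), of Q'] Q(2) unfolding Q(3) by blast
      then show ?thesis
        using hom[of _ "j - (k - b)"] by (auto simp: Der_piece_def multiples_def Der_mult_def)
    qed
    moreover have "{der_apply a p + n | a n. a \<in> ?V \<and> n \<in> ?N} = W (j - (k - b))"
      by (simp add: W_def)
    ultimately show ?thesis by (simp add: hilb_def)
  qed
  have W: "graded_ideal u W"
    unfolding graded_ideal_def
  proof (intro conjI allI ballI impI)
    fix j
    have "W j = {x + y | x y. x \<in> (\<lambda>a. der_apply a p) ` Der_piece u v Q' (j + k - b) \<and> y \<in> multiples u (p ^ e) j}"
      unfolding W_def by blast
    then show "mpoly.subspace (W j)"
      using mpoly.subspace_sums[OF der_mpoly.linear_subspace_image[OF linear_der_apply subspace_Der_piece] subspace_multiples]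
      by simp
    fix x assume x: "x \<in> W j"
    then obtain a n where a: "x = der_apply a p + n" "a \<in> Der_piece u v Q' (j + k - b)" "n \<in> multiples u (p ^ e) j"
      by (auto simp: W_def)
    then show "whomog u j x" using hom by (auto simp: multiples_def intro: whomog_add)
    fix d and q :: "('n, 'a) mpoly" assume q: "whomog u d q"
    have "q * x = der_apply (\<lambda>i. q * a i) p + q * n"
      by (simp add: a(1) der_apply_mult distrib_left)
    moreover have "(\<lambda>i. q * a i) \<in> Der_piece u v Q' (d + j + k - b)"
      using mult_piece[OF a(2) q] by (simp add: algebra_simps)
    moreover have "q * n \<in> multiples u (p ^ e) (d + j)"
      by (rule graded_ideal_mult[OF graded_ideal_multiples q a(3)])
    ultimately show "q * x \<in> W (d + j)" unfolding W_def by blast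
  qed
  obtain l where l: "pderiv_var l p \<noteq> 0" "\<not> p dvd pderiv_var l p"
    using irreducible_not_dvd_pderiv[OF u p] .
  let ?h = "Q' * pderiv_var l p"
  \<comment> \<open>The derivation Q' \<partial>_l sends every \<open>g\<close> to a multiple of
    \<open>Q'\<close>, hence of the required power of \<open>g\<close>. Its value on
    \<open>p\<close> is the second element of the coprime pair.\<close>
  have "unit_der l Q' \<in> Der_log Q'"
    using power_mult_in_dvd[OF _ Q'0] by (auto simp: Der_log_def Der_mult_def der_apply_unit_der)
  then have "unit_der l Q' \<in> Der_piece u v Q' (d' + v l)"
    using Q'(1) by (auto simp: Der_piece_def unit_der_def)
  moreover have "?h = der_apply (unit_der l Q') p + 0" by (simp add: der_apply_unit_der)
  moreover have "0 \<in> multiples u (p ^ e) (d' + v l - k + b)" by (simp add: multiples_def)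
  ultimately have hW: "?h \<in> W (d' + v l - k + b)"
    unfolding W_def by (intro CollectI exI[of _ "unit_der l Q'"] exI[of _ 0]) auto
  have gW: "p ^ e \<in> W (int e * b)"
    unfolding W_def using pe
    by (intro CollectI exI[of _ 0] exI[of _ "p ^ e"])
      (auto simp: multiples_def der.subspace_0[OF subspace_Der_piece])
  have "has_moments (num_on u UNIV (hilb_ideal W)) 1 0"
  proof (rule coprime_pair_moments[OF u W gW pe0 hW])
    show "?h \<noteq> 0" using l Q'0 by simp
    fix x assume x: "p ^ e dvd x" "?h dvd x"
    \<comment> \<open>Being prime and dividing neither factor of \<open>?h\<close>, \<open>p\<close>
      does not divide \<open>?h\<close>; this makes \<open>p ^ e\<close> and \<open>?h\<close>
      coprime.\<close>
    have not: "\<not> p dvd ?h" using mpoly_irreducible_prime[OF p(1)] Q'(2) l(2) by blast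
    obtain y where y: "x = ?h * y" using x(2) by auto
    then have "p ^ e dvd y" using x(1) irreducible_power_dvd_cancel[OF p(1) not] by blast
    then show "p ^ e * ?h dvd x" unfolding y by (metis dvd_refl mult.commute mult_dvd_mono)
  qed
  \<comment> \<open>Both ideals have rank 1 and the same shift \<open>k - b\<close>, so ranks and
    shifts cancel, and the degree \<open>int e * b\<close> of \<open>p ^ e\<close> remains.\<close>
  then have "has_moments (\<lambda>m. num_on u UNIV (\<lambda>j. int (hilb u v Q' j)) m
      + num_on u UNIV (hilb_ideal (multiples u (p ^ e))) (m - (k - b)) - num_on u UNIV (hilb_ideal W) (m - (k - b)))
      (r + 1 - 1) (c + (int e * b + (k - b) * 1) - (0 + (k - b) * 1))"
    using M multiples_moments[OF u pe pe0]
    by (intro has_moments_diff has_moments_add has_moments_shift)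
  moreover have "num_on u UNIV (\<lambda>j. int (hilb u v Q j)) = (\<lambda>m. num_on u UNIV (\<lambda>j. int (hilb u v Q' j)) m
      + num_on u UNIV (hilb_ideal (multiples u (p ^ e))) (m - (k - b)) - num_on u UNIV (hilb_ideal W) (m - (k - b)))"
    unfolding dims num_on_diff num_on_add
    using num_on_shift[of u UNIV "hilb_ideal (multiples u (p ^ e))"] num_on_shift[of u UNIV "hilb_ideal W"]
    by simp
  ultimately show ?thesis by simp
qed

text \<open>The value at 1 is the rank of the module, the number of variables, unchanged at each
  step. The induction is on the total degree, which drops because the prime factor split off is
  nonconstant.\<close>

theorem Der_log_moments:
  fixes u v :: "'n::finite \<Rightarrow> int" and Q :: "('n, 'a::field_char_0) mpoly"
  assumes u: "\<And>i. u i > 0" and k: "\<And>i. u i + v i = k" and "Q \<noteq> 0" "whomog u d Q"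
  shows "has_moments (num_on u UNIV (\<lambda>j. int (hilb u v Q j))) (int (card (UNIV :: 'n set))) (d + (\<Sum>i\<in>UNIV. v i))"
  using assms(3,4)
proof (induction "nat (tdeg Q)" arbitrary: Q d rule: less_induct)
  case less
  show ?case
  proof (cases "Q dvd 1")
    case True
    then obtain c where "c \<noteq> 0" "Q = single 0 c" by (rule mpoly_unitE)
    then have d: "d = 0" using less.prems whomog_single[of u 0 c] whomog_unique[of u d Q 0] by simp
    \<comment> \<open>A constant has no irreducible divisors, so all derivations are allowed: the
      module is free on the \<partial>_i, placed in degrees \<open>v i\<close>.\<close>
    have "\<not> (irreducible g \<and> g dvd Q)" for g
      using dvd_trans[OF _ True] by (auto simp: irreducible_def)
    then have "Der_log Q = UNIV" unfolding Der_log_def by blast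
    then have "Der_piece u v Q j = {a. \<forall>i. whomog u (j - v i) (a i) \<and> (i \<notin> UNIV \<longrightarrow> a i = 0)}" for j
      by (simp add: Der_piece_def)
    then have "hilb u v Q j = (\<Sum>i\<in>UNIV. mpoly.dim (multiples u (1 :: ('n, 'a) mpoly) (j - v i)))" for j
      using dim_homogeneous_ders[of u UNIV j v, OF u, where 'a = 'a] by (simp add: hilb_def)
    then have "num_on u UNIV (\<lambda>j. int (hilb u v Q j)) =
        (\<lambda>m. \<Sum>i\<in>UNIV. num_on u UNIV (hilb_ideal (multiples u (1 :: ('n, 'a) mpoly))) (m - v i))"
      using num_on_shift[of u UNIV "hilb_ideal (multiples u (1 :: ('n, 'a) mpoly))"]
      by (simp add: num_on_sum fun_eq_iff)
    moreover have "has_moments (\<lambda>m. \<Sum>i\<in>UNIV. num_on u UNIV (hilb_ideal (multiples u (1 :: ('n, 'a) mpoly))) (m - v i))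
        (\<Sum>i\<in>(UNIV :: 'n set). 1) (\<Sum>i\<in>UNIV. 0 + v i * 1)"
      by (intro has_moments_sum has_moments_shift multiples_moments u) auto
    ultimately show ?thesis by (simp add: d)
  next
    case False
    obtain p where p: "irreducible p" "p dvd Q" using mpoly_irreducible_divisor[OF less.prems(1) False] .
    define e where "e = mult_in p Q"
    obtain Q' where Q': "Q = p ^ e * Q'"
      using power_mult_in_dvd[OF p(1) less.prems(1)] by (auto simp: e_def elim: dvdE)
    have nz: "p \<noteq> 0" "p ^ e \<noteq> 0" "Q' \<noteq> 0" using Q' less.prems(1) p(1) by auto
    have e: "e \<ge> 1" using le_mult_in[OF p(1) less.prems(1), of 1] p(2) by (simp add: e_def)
    have "\<not> p dvd Q'"
    proof
      assume "p dvd Q'"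
      then have "p ^ e * p dvd Q" unfolding Q' by (intro mult_dvd_mono) auto
      then have "p ^ Suc e dvd Q" by (simp add: mult.commute)
      then show False using le_mult_in[OF p(1) less.prems(1)] unfolding e_def by fastforce
    qed
    have hp: "whomog u (maxdeg u p) p"
    proof -
      obtain s where s: "Q = p * s" using p(2) by auto
      show ?thesis using less.prems unfolding s by (intro whomog_factor[of u d p s])
    qed
    have hQ': "whomog u (maxdeg u Q') Q'"
      using less.prems unfolding Q' by (intro whomog_factor[of u d Q' "p ^ e"]) (auto simp: mult.commute)
    have d: "d = int e * maxdeg u p + maxdeg u Q'"
      using maxdeg_eq_whomog[OF less.prems(2,1)] maxdeg_mult[OF nz(2,3), of u] maxdeg_power[OF nz(1), of u e]
      by (simp flip: Q')
    have "tdeg Q = int e * tdeg p + tdeg Q'"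
      using maxdeg_mult[OF nz(2,3), of "\<lambda>_. 1"] maxdeg_power[OF nz(1), of "\<lambda>_. 1" e] by (simp flip: Q')
    moreover have "int e * tdeg p > 0" using e irreducible_tdeg_pos[OF p(1)] by simp
    moreover have "tdeg Q' \<ge> 0" using nz(3) by (intro maxdeg_nonneg) auto
    ultimately have "nat (tdeg Q') < nat (tdeg Q)" by simp
    then have "has_moments (num_on u UNIV (\<lambda>j. int (hilb u v Q' j))) (int (card (UNIV :: 'n set))) (maxdeg u Q' + (\<Sum>i\<in>UNIV. v i))"
      using nz(3) hQ' by (rule less.hyps)
    from Der_piece_split_moments[OF u k less.prems(1) Q' e_def p(1) hp hQ' \<open>\<not> p dvd Q'\<close> this]
    show ?thesis by (simp add: d algebra_simps)
  qed
qed

theorem mainTheorem11: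
  fixes u v :: "'n::finite \<Rightarrow> int" and Q :: "('n \<Rightarrow>\<^sub>0 nat) \<Rightarrow>\<^sub>0 'a::field_char_0"
    and k d :: int
  assumes "\<forall>i. u i > 0"
    and "Q \<noteq> 0" and "whomog u d Q"
    and "\<forall>i. u i + v i = k"
  shows "chi_der u v Q = d + (\<Sum>i\<in>UNIV. v i)"
proof -
  have "hilb_num u v Q = num_on u UNIV (\<lambda>j. int (hilb u v Q j))"
    by (rule ext) (simp add: hilb_num_def num_on_def)
  then show ?thesis
    using Der_log_moments[of u v k Q d] assms by (simp add: chi_der_def has_moments_def)
qed

end
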